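(* Let $V$ and $W$ be $C_\infty$ algebras, with Taylor coefficients $(Q_n)_{n\ge1}$ and $(R_n)_{n\ge1}$ respectively, and suppose $V$ is equipped with a decomposition as a direct sum of graded subspaces $V=X\oplus Y$ such that $\mathbf{s}Y\subset Q_1(\mathbf{s}X)$. If $F:V\to W$ is an $A_\infty$ morphism whose higher Taylor coefficients $F_n$, $n\ge2$, vanish whenever at least one of their arguments is in $\mathbf{s}X$, then $F$ is a $C_\infty$ morphism.
   Context: Vector spaces are over a field $\Bbbk$ of characteristic zero. For a graded vector space $V$, $\mathbf{s}V$ is the suspension, $(\mathbf{s}V)^i=V^{i+1}$. $\overline{T}(V)=\bigoplus_{n\ge1}V^{\otimes n}$ carries the deconcatenation coproduct. An $A_\infty$ algebra structure on $V$ is a degree $1$ coderivation $Q$ of $\overline{T}(\mathbf{s}V)$ with $Q^2=0$; it is determined by its Taylor coefficients $Q_n:(\mathbf{s}V)^{\otimes n}\to\mathbf{s}V$. An $A_\infty$ morphism $F:V\to W$ is a morphism of dg coalgebras $\overline{T}(\mathbf{s}V)\to\overline{T}(\mathbf{s}W)$, determined by its Taylor coefficients $F_n:(\mathbf{s}V)^{\otimes n}\to\mathbf{s}W$. The shuffle product on $\overline{T}(V)$ is $(v_1\otimes\cdots\otimes v_p)\circledast(v_{p+1}\otimes\cdots\otimes v_n)=\sum_{\sigma}\varepsilon(\sigma)v_{\sigma^{-1}(1)}\otimes\cdots\otimes v_{\sigma^{-1}(n)}$, over $\sigma\in S_n$ with $\sigma(i)<\sigma(i+1)$ for all $i\ne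 p$, $\varepsilon(\sigma)$ being the Koszul sign. A $C_\infty$ algebra is an $A_\infty$ algebra whose codifferential is also a derivation of $(\overline{T}(\mathbf{s}V),\circledast)$ (equivalently, its Taylor coefficients vanish on the image of $\circledast$). A $C_\infty$ morphism between $C_\infty$ algebras is an $A_\infty$ morphism which is also multiplicative for $\circledast$, i.e. a morphism of dg bialgebras (equivalently, its Taylor coefficients vanish on the image of $\circledast$). *)

theory Defs
  imports Complex_Main "HOL-Library.Poly_Mapping" "HOL-Combinatorics.Permutations"
begin

section \<open>Graded vector spaces\<close>

text \<open>
  A graded vector space is a family \<open>(V i)\<close>, indexed by the integers, of subspaces of some ambient
  vector space (with scalar multiplication \<open>sc\<close>); the ambient space only provides the operations.
  The total space is the external direct sum of the \<open>V i\<close>: the subspaces need not be independent,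
  because every vector is used together with its degree.  An element of the total space is the
  function sending each degree to its component.
\<close>

definition graded_space :: "('k::field_char_0 \<Rightarrow> 'v::ab_group_add \<Rightarrow> 'v) \<Rightarrow> (int \<Rightarrow> 'v set) \<Rightarrow> bool" where
  "graded_space sc V \<longleftrightarrow> vector_space sc \<and> (\<forall>i. module.subspace sc (V i))"

definition susp :: "(int \<Rightarrow> 'v set) \<Rightarrow> int \<Rightarrow> 'v set" where
  "susp V i = V (i + 1)"

definition graded_direct_sum ::
  "('k::field_char_0 \<Rightarrow> 'v::ab_group_add \<Rightarrow> 'v) \<Rightarrow> (int \<Rightarrow> 'v set) \<Rightarrow> (int \<Rightarrow> 'v set) \<Rightarrow> (int \<Rightarrow> 'v set) \<Rightarrow> bool" where
  "graded_direct_sum sc V X Y \<longleftrightarrow>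
     graded_space sc X \<and> graded_space sc Y \<and>
     (\<forall>i. X i \<inter> Y i = {0} \<and> V i = {x + y | x y. x \<in> X i \<and> y \<in> Y i})"


section \<open>Free vector spaces\<close>

definition fscale :: "'k::field_char_0 \<Rightarrow> ('a \<Rightarrow>\<^sub>0 'k) \<Rightarrow> ('a \<Rightarrow>\<^sub>0 'k)" where
  "fscale c t = Poly_Mapping.map ((*) c) t"

definition gen :: "'a \<Rightarrow> ('a \<Rightarrow>\<^sub>0 'k::field_char_0)" where
  "gen a = Poly_Mapping.single a 1"

definition lin_ext :: "('a \<Rightarrow> ('b \<Rightarrow>\<^sub>0 'k)) \<Rightarrow> ('a \<Rightarrow>\<^sub>0 'k::field_char_0) \<Rightarrow> ('b \<Rightarrow>\<^sub>0 'k)" where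
  "lin_ext f t = (\<Sum>a\<in>Poly_Mapping.keys t. fscale (Poly_Mapping.lookup t a) (f a))"

definition flinear :: "(('a \<Rightarrow>\<^sub>0 'k::field_char_0) \<Rightarrow> ('b \<Rightarrow>\<^sub>0 'k)) \<Rightarrow> bool" where
  "flinear f \<longleftrightarrow> Vector_Spaces.linear fscale fscale f"


section \<open>The reduced tensor space\<close>

text \<open>
  A letter \<open>(i, v)\<close> is a homogeneous vector \<open>v\<close> together with its degree \<open>i\<close>, and the word
  \<open>[(i1,v1),\<dots>,(in,vn)]\<close> stands for the tensor \<open>v1 \<otimes> \<dots> \<otimes> vn\<close>.  The reduced tensor space on \<open>V\<close>
  is the quotient of the free vector space \<open>tbar V\<close> on the nonempty words by the subspace
  \<open>tnull sc V\<close> spanned by the multilinearity relations.  The quotient is not formed as a type: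
  its elements are represented in \<open>tbar V\<close>, equality is the congruence \<open>teq\<close>, and its linear maps
  are represented by linear maps of free vector spaces that respect \<open>tbar\<close> and \<open>tnull\<close>.
\<close>

type_synonym 'v word = "(int \<times> 'v) list"

definition words :: "(int \<Rightarrow> 'v set) \<Rightarrow> 'v word set" where
  "words V = {w. w \<noteq> [] \<and> (\<forall>(i, v) \<in> set w. v \<in> V i)}"

definition wdeg :: "'v word \<Rightarrow> int" where
  "wdeg w = sum_list (map fst w)"

definition tbar :: "(int \<Rightarrow> 'v set) \<Rightarrow> ('v word \<Rightarrow>\<^sub>0 'k::field_char_0) set" where
  "tbar V = {t. Poly_Mapping.keys t \<subseteq> words V}"

definition tbar_deg :: "(int \<Rightarrow> 'v set) \<Rightarrow> int \<Rightarrow> ('v word \<Rightarrow>\<^sub>0 'k::field_char_0) set" where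
  "tbar_deg V d = {t \<in> tbar V. \<forall>w \<in> Poly_Mapping.keys t. wdeg w = d}"

definition tnull :: "('k::field_char_0 \<Rightarrow> 'v::ab_group_add \<Rightarrow> 'v) \<Rightarrow> (int \<Rightarrow> 'v set) \<Rightarrow> ('v word \<Rightarrow>\<^sub>0 'k) set" where
  "tnull sc V = module.span fscale
     {gen (w[k := (i, sc a x + sc b y)]) - fscale a (gen (w[k := (i, x)])) - fscale b (gen (w[k := (i, y)]))
      | w k i a b x y. w \<in> words V \<and> k < length w \<and> x \<in> V i \<and> y \<in> V i}"

definition teq :: "('k::field_char_0 \<Rightarrow> 'v::ab_group_add \<Rightarrow> 'v) \<Rightarrow> (int \<Rightarrow> 'v set) \<Rightarrow>
    ('v word \<Rightarrow>\<^sub>0 'k) \<Rightarrow> ('v word \<Rightarrow>\<^sub>0 'k) \<Rightarrow> bool" where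
  "teq sc V s t \<longleftrightarrow> s - t \<in> tnull sc V"

definition tensor_map ::
  "('k::field_char_0 \<Rightarrow> 'v::ab_group_add \<Rightarrow> 'v) \<Rightarrow> (int \<Rightarrow> 'v set) \<Rightarrow>
   ('k \<Rightarrow> 'w::ab_group_add \<Rightarrow> 'w) \<Rightarrow> (int \<Rightarrow> 'w set) \<Rightarrow> int \<Rightarrow>
   (('v word \<Rightarrow>\<^sub>0 'k) \<Rightarrow> ('w word \<Rightarrow>\<^sub>0 'k)) \<Rightarrow> bool" where
  \<comment> \<open>\<open>f\<close> represents a linear map of degree \<open>d\<close> between the reduced tensor spaces\<close>
  "tensor_map scV V scW W d f \<longleftrightarrow>
     flinear f \<and> f ` tbar V \<subseteq> tbar W \<and> f ` tnull scV V \<subseteq> tnull scW W \<and>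
     (\<forall>w \<in> words V. \<exists>t \<in> tbar_deg W (wdeg w + d). teq scW W (f (gen w)) t)"


section \<open>Deconcatenation coproduct\<close>

text \<open>
  The tensor square of the reduced tensor space is presented likewise: the free vector space on
  pairs of nonempty words, modulo the span \<open>tnull2\<close> of \<open>n \<otimes> t\<close> and \<open>t \<otimes> n\<close>, for \<open>n\<close> in \<open>tnull\<close>.
\<close>

definition otimes :: "('a \<Rightarrow>\<^sub>0 'k::field_char_0) \<Rightarrow> ('b \<Rightarrow>\<^sub>0 'k) \<Rightarrow> ('a \<times> 'b \<Rightarrow>\<^sub>0 'k)" where
  "otimes s t = lin_ext (\<lambda>a. lin_ext (\<lambda>b. gen (a, b)) t) s"

definition tnull2 :: "('k::field_char_0 \<Rightarrow> 'v::ab_group_add \<Rightarrow> 'v) \<Rightarrow> (int \<Rightarrow> 'v set) \<Rightarrow>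
    ('v word \<times> 'v word \<Rightarrow>\<^sub>0 'k) set" where
  "tnull2 sc V = module.span fscale
     ({otimes n t | n t. n \<in> tnull sc V \<and> t \<in> tbar V} \<union> {otimes t n | n t. n \<in> tnull sc V \<and> t \<in> tbar V})"

definition teq2 :: "('k::field_char_0 \<Rightarrow> 'v::ab_group_add \<Rightarrow> 'v) \<Rightarrow> (int \<Rightarrow> 'v set) \<Rightarrow>
    ('v word \<times> 'v word \<Rightarrow>\<^sub>0 'k) \<Rightarrow> ('v word \<times> 'v word \<Rightarrow>\<^sub>0 'k) \<Rightarrow> bool" where
  "teq2 sc V s t \<longleftrightarrow> s - t \<in> tnull2 sc V"

definition coproduct :: "('v word \<Rightarrow>\<^sub>0 'k::field_char_0) \<Rightarrow> ('v word \<times> 'v word \<Rightarrow>\<^sub>0 'k)" where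
  "coproduct = lin_ext (\<lambda>w. \<Sum>k\<in>{1..<length w}. gen (take k w, drop k w))"

definition map_otimes :: "(('v word \<Rightarrow>\<^sub>0 'k::field_char_0) \<Rightarrow> ('w word \<Rightarrow>\<^sub>0 'k)) \<Rightarrow> int \<Rightarrow>
    (('v word \<Rightarrow>\<^sub>0 'k) \<Rightarrow> ('w word \<Rightarrow>\<^sub>0 'k)) \<Rightarrow> ('v word \<times> 'v word \<Rightarrow>\<^sub>0 'k) \<Rightarrow> ('w word \<times> 'w word \<Rightarrow>\<^sub>0 'k)" where
  \<comment> \<open>the map \<open>f \<otimes> g\<close> with its Koszul sign, \<open>e\<close> being the degree of \<open>g\<close>\<close>
  "map_otimes f e g =
     lin_ext (\<lambda>(u, v). fscale ((-1) powi (e * wdeg u)) (otimes (f (gen u)) (g (gen v))))"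


section \<open>Shuffle product\<close>

text \<open>
  Positions are counted from 0, so the only possible descent of a shuffle of \<open>p\<close> and \<open>n - p\<close> letters
  is from position \<open>p - 1\<close> to position \<open>p\<close>.
\<close>

definition shuffle_perms :: "nat \<Rightarrow> nat \<Rightarrow> (nat \<Rightarrow> nat) set" where
  "shuffle_perms p n = {\<sigma>. \<sigma> permutes {..<n} \<and> (\<forall>i. i + 1 < n \<and> i + 1 \<noteq> p \<longrightarrow> \<sigma> i < \<sigma> (i + 1))}"

definition koszul_sign :: "(nat \<Rightarrow> nat) \<Rightarrow> 'v word \<Rightarrow> 'k::field_char_0" where
  "koszul_sign \<sigma> w =
     (\<Prod>(i, j) \<in> {(i, j). i < j \<and> j < length w \<and> \<sigma> j < \<sigma> i}. (-1) powi (fst (w ! i) * fst (w ! j)))"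

definition permute_word :: "(nat \<Rightarrow> nat) \<Rightarrow> 'v word \<Rightarrow> 'v word" where
  "permute_word \<sigma> w = map (\<lambda>j. w ! (inv \<sigma> j)) [0..<length w]"

definition shuffle_words :: "'v word \<Rightarrow> 'v word \<Rightarrow> ('v word \<Rightarrow>\<^sub>0 'k::field_char_0)" where
  "shuffle_words u v =
     (\<Sum>\<sigma> \<in> shuffle_perms (length u) (length (u @ v)).
        fscale (koszul_sign \<sigma> (u @ v)) (gen (permute_word \<sigma> (u @ v))))"

definition shuffle :: "('v word \<Rightarrow>\<^sub>0 'k::field_char_0) \<Rightarrow> ('v word \<Rightarrow>\<^sub>0 'k) \<Rightarrow> ('v word \<Rightarrow>\<^sub>0 'k)" where
  "shuffle s t = lin_ext (\<lambda>u. lin_ext (\<lambda>v. shuffle_words u v) t) s"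


section \<open>Taylor coefficients\<close>

text \<open>
  \<open>cogen sc t\<close> is the projection of \<open>t\<close> to the words of length one, as an element of the total space;
  \<open>taylor sc f w\<close> is the value of the Taylor coefficient \<open>f\<^sub>n\<close>, \<open>n = length w\<close>, at the tensor \<open>w\<close>.
\<close>

definition cogen :: "('k::field_char_0 \<Rightarrow> 'v::ab_group_add \<Rightarrow> 'v) \<Rightarrow> ('v word \<Rightarrow>\<^sub>0 'k) \<Rightarrow> int \<Rightarrow> 'v" where
  "cogen sc t d =
     (\<Sum>w \<in> {w \<in> Poly_Mapping.keys t. length w = 1 \<and> fst (hd w) = d}. sc (Poly_Mapping.lookup t w) (snd (hd w)))"

definition taylor :: "('k::field_char_0 \<Rightarrow> 'w::ab_group_add \<Rightarrow> 'w) \<Rightarrow>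
    (('v word \<Rightarrow>\<^sub>0 'k) \<Rightarrow> ('w word \<Rightarrow>\<^sub>0 'k)) \<Rightarrow> 'v word \<Rightarrow> int \<Rightarrow> 'w" where
  "taylor sc f w = cogen sc (f (gen w))"


section \<open>Homotopy algebras and their morphisms\<close>

text \<open>All identities between maps are imposed on words, whose classes span the reduced tensor space.\<close>

definition coderivation :: "('k::field_char_0 \<Rightarrow> 'v::ab_group_add \<Rightarrow> 'v) \<Rightarrow> (int \<Rightarrow> 'v set) \<Rightarrow> int \<Rightarrow>
    (('v word \<Rightarrow>\<^sub>0 'k) \<Rightarrow> ('v word \<Rightarrow>\<^sub>0 'k)) \<Rightarrow> bool" where
  "coderivation sc V d Q \<longleftrightarrow>
     tensor_map sc V sc V d Q \<and>
     (\<forall>w \<in> words V. teq2 sc V (coproduct (Q (gen w)))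
        (map_otimes Q 0 id (coproduct (gen w)) + map_otimes id d Q (coproduct (gen w))))"

definition shuffle_derivation :: "('k::field_char_0 \<Rightarrow> 'v::ab_group_add \<Rightarrow> 'v) \<Rightarrow> (int \<Rightarrow> 'v set) \<Rightarrow> int \<Rightarrow>
    (('v word \<Rightarrow>\<^sub>0 'k) \<Rightarrow> ('v word \<Rightarrow>\<^sub>0 'k)) \<Rightarrow> bool" where
  "shuffle_derivation sc V d Q \<longleftrightarrow>
     (\<forall>u \<in> words V. \<forall>v \<in> words V. teq sc V (Q (shuffle (gen u) (gen v)))
        (shuffle (Q (gen u)) (gen v) + fscale ((-1) powi (d * wdeg u)) (shuffle (gen u) (Q (gen v)))))"

definition coalgebra_morphism ::
  "('k::field_char_0 \<Rightarrow> 'v::ab_group_add \<Rightarrow> 'v) \<Rightarrow> (int \<Rightarrow> 'v set) \<Rightarrow>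
   ('k \<Rightarrow> 'w::ab_group_add \<Rightarrow> 'w) \<Rightarrow> (int \<Rightarrow> 'w set) \<Rightarrow>
   (('v word \<Rightarrow>\<^sub>0 'k) \<Rightarrow> ('w word \<Rightarrow>\<^sub>0 'k)) \<Rightarrow> bool" where
  "coalgebra_morphism scV V scW W F \<longleftrightarrow>
     tensor_map scV V scW W 0 F \<and>
     (\<forall>w \<in> words V. teq2 scW W (coproduct (F (gen w))) (map_otimes F 0 F (coproduct (gen w))))"

definition shuffle_morphism ::
  "(int \<Rightarrow> 'v set) \<Rightarrow> ('k \<Rightarrow> 'w::ab_group_add \<Rightarrow> 'w) \<Rightarrow> (int \<Rightarrow> 'w set) \<Rightarrow>
   (('v word \<Rightarrow>\<^sub>0 'k::field_char_0) \<Rightarrow> ('w word \<Rightarrow>\<^sub>0 'k)) \<Rightarrow> bool" where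
  "shuffle_morphism V scW W F \<longleftrightarrow>
     (\<forall>u \<in> words V. \<forall>v \<in> words V.
        teq scW W (F (shuffle (gen u) (gen v))) (shuffle (F (gen u)) (F (gen v))))"

definition A_inf_algebra :: "('k::field_char_0 \<Rightarrow> 'v::ab_group_add \<Rightarrow> 'v) \<Rightarrow> (int \<Rightarrow> 'v set) \<Rightarrow>
    (('v word \<Rightarrow>\<^sub>0 'k) \<Rightarrow> ('v word \<Rightarrow>\<^sub>0 'k)) \<Rightarrow> bool" where
  "A_inf_algebra sc V Q \<longleftrightarrow>
     graded_space sc V \<and> coderivation sc (susp V) 1 Q \<and>
     (\<forall>w \<in> words (susp V). teq sc (susp V) (Q (Q (gen w))) 0)"

definition C_inf_algebra :: "('k::field_char_0 \<Rightarrow> 'v::ab_group_add \<Rightarrow> 'v) \<Rightarrow> (int \<Rightarrow> 'v set) \<Rightarrow>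
    (('v word \<Rightarrow>\<^sub>0 'k) \<Rightarrow> ('v word \<Rightarrow>\<^sub>0 'k)) \<Rightarrow> bool" where
  "C_inf_algebra sc V Q \<longleftrightarrow> A_inf_algebra sc V Q \<and> shuffle_derivation sc (susp V) 1 Q"

definition A_inf_morphism ::
  "('k::field_char_0 \<Rightarrow> 'v::ab_group_add \<Rightarrow> 'v) \<Rightarrow> (int \<Rightarrow> 'v set) \<Rightarrow> (('v word \<Rightarrow>\<^sub>0 'k) \<Rightarrow> ('v word \<Rightarrow>\<^sub>0 'k)) \<Rightarrow>
   ('k \<Rightarrow> 'w::ab_group_add \<Rightarrow> 'w) \<Rightarrow> (int \<Rightarrow> 'w set) \<Rightarrow> (('w word \<Rightarrow>\<^sub>0 'k) \<Rightarrow> ('w word \<Rightarrow>\<^sub>0 'k)) \<Rightarrow>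
   (('v word \<Rightarrow>\<^sub>0 'k) \<Rightarrow> ('w word \<Rightarrow>\<^sub>0 'k)) \<Rightarrow> bool" where
  "A_inf_morphism scV V Q scW W R F \<longleftrightarrow>
     A_inf_algebra scV V Q \<and> A_inf_algebra scW W R \<and>
     coalgebra_morphism scV (susp V) scW (susp W) F \<and>
     (\<forall>w \<in> words (susp V). teq scW (susp W) (F (Q (gen w))) (R (F (gen w))))"

definition C_inf_morphism ::
  "('k::field_char_0 \<Rightarrow> 'v::ab_group_add \<Rightarrow> 'v) \<Rightarrow> (int \<Rightarrow> 'v set) \<Rightarrow> (('v word \<Rightarrow>\<^sub>0 'k) \<Rightarrow> ('v word \<Rightarrow>\<^sub>0 'k)) \<Rightarrow>
   ('k \<Rightarrow> 'w::ab_group_add \<Rightarrow> 'w) \<Rightarrow> (int \<Rightarrow> 'w set) \<Rightarrow> (('w word \<Rightarrow>\<^sub>0 'k) \<Rightarrow> ('w word \<Rightarrow>\<^sub>0 'k)) \<Rightarrow>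
   (('v word \<Rightarrow>\<^sub>0 'k) \<Rightarrow> ('w word \<Rightarrow>\<^sub>0 'k)) \<Rightarrow> bool" where
  "C_inf_morphism scV V Q scW W R F \<longleftrightarrow>
     C_inf_algebra scV V Q \<and> C_inf_algebra scW W R \<and>
     A_inf_morphism scV V Q scW W R F \<and> shuffle_morphism (susp V) scW (susp W) F"



section \<open>The operations descend to the quotient\<close>

lemma lookup_fscale [simp]: "Poly_Mapping.lookup (fscale c t) a = c * Poly_Mapping.lookup t a"
  unfolding fscale_def by (simp add: map.rep_eq when_def)

interpretation free: vector_space "fscale :: 'k::field_char_0 \<Rightarrow> ('a \<Rightarrow>\<^sub>0 'k) \<Rightarrow> _"
  by unfold_locales (auto intro!: poly_mapping_eqI simp: lookup_add algebra_simps)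

lemma lin_ext_superset:
  assumes "finite S" "Poly_Mapping.keys t \<subseteq> S"
  shows "lin_ext f t = (\<Sum>a\<in>S. fscale (Poly_Mapping.lookup t a) (f a))"
  unfolding lin_ext_def using assms
  by (intro sum.mono_neutral_left) (auto simp: in_keys_iff)

lemma lin_ext_add: "lin_ext f (s + t) = lin_ext f s + lin_ext f t"
proof -
  let ?S = "Poly_Mapping.keys s \<union> Poly_Mapping.keys t"
  have "Poly_Mapping.keys (s + t) \<subseteq> ?S" by (rule Poly_Mapping.keys_add)
  then show ?thesis
    by (simp add: lin_ext_superset [of ?S] lookup_add free.scale_left_distrib sum.distrib)
qed

lemma lin_ext_fscale: "lin_ext f (fscale c t) = fscale c (lin_ext f t)"
proof -
  have "Poly_Mapping.keys (fscale c t) \<subseteq> Poly_Mapping.keys t" by (auto simp: in_keys_iff)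
  then show ?thesis
    by (simp add: lin_ext_superset [of "Poly_Mapping.keys t"] free.scale_sum_right)
qed

lemma flinear_lin_ext: "flinear (lin_ext f)"
  unfolding flinear_def by unfold_locales (simp_all add: lin_ext_add lin_ext_fscale)

lemma lin_ext_gen [simp]: "lin_ext f (gen a) = f a"
  by (simp add: lin_ext_def gen_def)

lemma flinear_span_subset:
  assumes "flinear f" "\<And>g. g \<in> B \<Longrightarrow> f g \<in> module.span fscale C" "t \<in> module.span fscale B"
  shows "f t \<in> module.span fscale C"
proof -
  interpret f: Vector_Spaces.linear fscale fscale f using assms(1) unfolding flinear_def .
  show ?thesis
    using assms(3)
  proof (induction rule: free.span_induct_alt)
    case base then show ?case by (simp add: f.zero free.span_zero)
  next
    case (step c x y) then show ?case
      by (simp add: f.add f.scale free.span_add free.span_scale assms(2))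
  qed
qed

lemma cogen_superset:
  assumes "vector_space sc" "finite S" "Poly_Mapping.keys t \<subseteq> S"
  shows "cogen sc t d = (\<Sum>w \<in> {w \<in> S. length w = 1 \<and> fst (hd w) = d}. sc (Poly_Mapping.lookup t w) (snd (hd w)))"
proof -
  interpret vector_space sc by fact
  show ?thesis
  unfolding cogen_def using assms(2,3)
  by (intro sum.mono_neutral_left) (auto simp: in_keys_iff)
qed

lemma cogen_tnull:
  assumes "vector_space sc" "n \<in> tnull sc V"
  shows "cogen sc n d = 0"
proof -
  interpret vs: vector_space sc by fact
  have add: "cogen sc (s + t) d = cogen sc s d + cogen sc t d" for s t
  proof -
    let ?S = "Poly_Mapping.keys s \<union> Poly_Mapping.keys t"
    have "Poly_Mapping.keys (s + t) \<subseteq> ?S" by (rule Poly_Mapping.keys_add)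
    then show ?thesis
      by (simp add: cogen_superset [OF assms(1), of ?S] lookup_add vs.scale_left_distrib sum.distrib)
  qed
  have scl: "cogen sc (fscale c t) d = sc c (cogen sc t d)" for c t
  proof -
    have "Poly_Mapping.keys (fscale c t) \<subseteq> Poly_Mapping.keys t" by (auto simp: in_keys_iff)
    then show ?thesis
      by (simp add: cogen_superset [OF assms(1), of "Poly_Mapping.keys t"] vs.scale_sum_right)
  qed
  have df: "cogen sc (s - t) d = cogen sc s d - cogen sc t d" for s t
    using add[of "s - t" t] by simp
  have g: "cogen sc (gen w) d = (if length w = 1 \<and> fst (hd w) = d then snd (hd w) else 0)" for w
  proof -
    have "{w'. w' = w \<and> length w' = Suc 0 \<and> fst (hd w') = d} = (if length w = 1 \<and> fst (hd w) = d then {w} else {})"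
      by auto
    then show ?thesis unfolding cogen_def gen_def by simp
  qed
  show ?thesis using assms(2) unfolding tnull_def
  proof (induction rule: free.span_induct_alt)
    case base then show ?case by (simp add: cogen_def)
  next
    case (step c x y)
    then obtain w :: "'b word" and k i a b x' y' where w: "w \<in> words V" "k < length w"
       and x: "x = gen (w[k := (i, sc a x' + sc b y')]) - fscale a (gen (w[k := (i, x')])) - fscale b (gen (w[k := (i, y')]))"
      by blast
    have "cogen sc x d = 0"
      using w(2) by (cases w) (auto simp: x df scl g split: nat.split)
    then show ?case using step by (simp add: add scl)
  qed
qed


lemma flinear_diff: assumes "flinear f" shows "f (s - t) = f s - f t"
proof -
  interpret f: Vector_Spaces.linear fscale fscale f using assms(1) unfolding flinear_def .
  show ?thesis by (rule f.diff)
qed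

lemma flinear_fscale: assumes "flinear f" shows "f (fscale c t) = fscale c (f t)"
proof -
  interpret f: Vector_Spaces.linear fscale fscale f using assms(1) unfolding flinear_def .
  show ?thesis by (rule f.scale)
qed

lemmas lin_ext_linear = lin_ext_add lin_ext_fscale flinear_diff [OF flinear_lin_ext]

lemma koszul_sign_update:
  "k < length w \<Longrightarrow> koszul_sign \<sigma> (w[k := (i, x)]) = koszul_sign \<sigma> (w[k := (i, y)])"
  unfolding koszul_sign_def by (auto intro!: prod.cong simp: nth_list_update)

lemma permute_word_update:
  assumes "\<sigma> permutes {..<length w}" "k < length w"
  shows "permute_word \<sigma> (w[k := l]) = (permute_word \<sigma> w)[\<sigma> k := l]"
proof (rule nth_equalityI)
  fix j assume "j < length (permute_word \<sigma> (w[k := l]))"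
  then have j: "j < length w" by (simp add: permute_word_def)
  have "inv \<sigma> j < length w" using permutes_in_image[OF permutes_inv[OF assms(1)], of j] j by simp
  moreover have "inv \<sigma> j = k \<longleftrightarrow> \<sigma> k = j" using permutes_inv_eq[OF assms(1), of j k] by auto
  ultimately show "permute_word \<sigma> (w[k := l]) ! j = (permute_word \<sigma> w)[\<sigma> k := l] ! j"
    using j by (auto simp: permute_word_def nth_list_update)
qed (simp add: permute_word_def)

lemma permute_word_words:
  assumes "\<sigma> permutes {..<length w}" "w \<in> words V"
  shows "permute_word \<sigma> w \<in> words V"
proof -
  have "inv \<sigma> j < length w" if "j < length w" for j
    using permutes_in_image[OF permutes_inv[OF assms(1)], of j] that by simp
  then show ?thesis using assms(2) unfolding words_def permute_word_def by fastforce
qed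

lemma tnull_gen:
  assumes "w \<in> words V" "k < length w" "x \<in> V i" "y \<in> V i"
  shows "gen (w[k := (i, sc a x + sc b y)]) - fscale a (gen (w[k := (i, x)])) - fscale b (gen (w[k := (i, y)]))
     \<in> tnull sc V"
  unfolding tnull_def by (rule free.span_base) (use assms in blast)

lemma shuffle_words_update_tnull:
  assumes S_def: "S = shuffle_perms p (length w)"
    and "w \<in> words V" "k < length w" "x \<in> V i" "y \<in> V i"
  defines "h \<equiv> \<lambda>z. \<Sum>\<sigma> \<in> S. fscale (koszul_sign \<sigma> (w[k := (i, z)])) (gen (permute_word \<sigma> (w[k := (i, z)])))"
  shows "h (sc a x + sc b y) - fscale a (h x) - fscale b (h y) \<in> tnull sc V"
proof -
  have "h (sc a x + sc b y) - fscale a (h x) - fscale b (h y) =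
    (\<Sum>\<sigma>\<in>S. fscale (koszul_sign \<sigma> (w[k := (i, x)]))
        (gen ((permute_word \<sigma> w)[\<sigma> k := (i, sc a x + sc b y)])
         - fscale a (gen ((permute_word \<sigma> w)[\<sigma> k := (i, x)])) - fscale b (gen ((permute_word \<sigma> w)[\<sigma> k := (i, y)]))))"
    unfolding h_def free.scale_sum_right sum_subtractf [symmetric]
  proof (rule sum.cong [OF refl])
    fix \<sigma> assume "\<sigma> \<in> S"
    then have p: "\<sigma> permutes {..<length w}" by (simp add: S_def shuffle_perms_def)
    show "fscale (koszul_sign \<sigma> (w[k := (i, sc a x + sc b y)])) (gen (permute_word \<sigma> (w[k := (i, sc a x + sc b y)]))) -
         fscale a (fscale (koszul_sign \<sigma> (w[k := (i, x)])) (gen (permute_word \<sigma> (w[k := (i, x)])))) -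
         fscale b (fscale (koszul_sign \<sigma> (w[k := (i, y)])) (gen (permute_word \<sigma> (w[k := (i, y)])))) =
         fscale (koszul_sign \<sigma> (w[k := (i, x)]))
          (gen ((permute_word \<sigma> w)[\<sigma> k := (i, sc a x + sc b y)]) - fscale a (gen ((permute_word \<sigma> w)[\<sigma> k := (i, x)])) -
           fscale b (gen ((permute_word \<sigma> w)[\<sigma> k := (i, y)])))"
      unfolding permute_word_update [OF p assms(3)] koszul_sign_update [OF assms(3), of \<sigma> i "sc a x + sc b y" x]
        koszul_sign_update [OF assms(3), of \<sigma> i y x]
      by (simp add: free.scale_right_diff_distrib mult.commute)
  qed
  also have "\<dots> \<in> tnull sc V"
    unfolding tnull_def
  proof (intro free.span_sum free.span_scale, fold tnull_def, rule tnull_gen)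
    fix \<sigma> assume "\<sigma> \<in> S"
    then have p: "\<sigma> permutes {..<length w}" by (simp add: S_def shuffle_perms_def)
    show "permute_word \<sigma> w \<in> words V" using permute_word_words [OF p assms(2)] .
    show "\<sigma> k < length (permute_word \<sigma> w)"
      using permutes_in_image[OF p, of k] assms(3) by (simp add: permute_word_def)
  qed (use assms in auto)
  finally show ?thesis .
qed

lemma shuffle_tnull_left:
  assumes "n \<in> tnull sc V" "v \<in> words V"
  shows "shuffle n (gen v) \<in> tnull sc V"
proof -
  have "shuffle n (gen v) = lin_ext (\<lambda>u. shuffle_words u v) n" by (simp add: shuffle_def)
  also have "\<dots> \<in> tnull sc V"
    using assms(1) unfolding tnull_def
  proof (rule flinear_span_subset [OF flinear_lin_ext, rotated], fold tnull_def)
    fix g :: "'a word \<Rightarrow>\<^sub>0 'b"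
    assume "g \<in> {gen (w[k := (i, sc a x + sc b y)]) - fscale a (gen (w[k := (i, x)])) - fscale b (gen (w[k := (i, y)]))
      | w k i a b x y. w \<in> words V \<and> k < length w \<and> x \<in> V i \<and> y \<in> V i}"
    then obtain w k i a b x y where *: "w \<in> words V" "k < length w" "x \<in> V i" "y \<in> V i"
      and g: "g = gen (w[k := (i, sc a x + sc b y)]) - fscale a (gen (w[k := (i, x)])) - fscale b (gen (w[k := (i, y)]))"
      by blast
    have "w @ v \<in> words V" using * assms(2) by (auto simp: words_def)
    from shuffle_words_update_tnull [OF refl this, where k = k and p = "length w" and i = i and x = x and y = y and sc = sc and a = a and b = b] *
    show "lin_ext (\<lambda>u. shuffle_words u v) g \<in> tnull sc V"
      by (simp add: g lin_ext_linear shuffle_words_def list_update_append)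
  qed
  finally show ?thesis .
qed

lemma shuffle_tnull_right:
  assumes "n \<in> tnull sc V" "u \<in> words V"
  shows "shuffle (gen u) n \<in> tnull sc V"
proof -
  have "shuffle (gen u) n = lin_ext (shuffle_words u) n" by (simp add: shuffle_def)
  also have "\<dots> \<in> tnull sc V"
    using assms(1) unfolding tnull_def
  proof (rule flinear_span_subset [OF flinear_lin_ext, rotated], fold tnull_def)
    fix g :: "'a word \<Rightarrow>\<^sub>0 'b"
    assume "g \<in> {gen (w[k := (i, sc a x + sc b y)]) - fscale a (gen (w[k := (i, x)])) - fscale b (gen (w[k := (i, y)]))
      | w k i a b x y. w \<in> words V \<and> k < length w \<and> x \<in> V i \<and> y \<in> V i}"
    then obtain w k i a b x y where *: "w \<in> words V" "k < length w" "x \<in> V i" "y \<in> V i"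
      and g: "g = gen (w[k := (i, sc a x + sc b y)]) - fscale a (gen (w[k := (i, x)])) - fscale b (gen (w[k := (i, y)]))"
      by blast
    have "u @ w \<in> words V" using * assms(2) by (auto simp: words_def)
    from shuffle_words_update_tnull [OF refl this, where k = "length u + k" and p = "length u" and i = i and x = x and y = y and sc = sc and a = a and b = b] *
    show "lin_ext (shuffle_words u) g \<in> tnull sc V"
      by (simp add: g lin_ext_linear shuffle_words_def list_update_append)
  qed
  finally show ?thesis .
qed

lemma otimes_gen [simp]: "otimes (gen u) (gen v) = gen (u, v)"
  by (simp add: otimes_def)

lemma coproduct_tnull:
  assumes "n \<in> tnull sc V"
  shows "coproduct n \<in> tnull2 sc V"
  using assms unfolding tnull_def tnull2_def coproduct_def
proof (rule flinear_span_subset [OF flinear_lin_ext, rotated], fold tnull_def tnull2_def)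
  fix g :: "'a word \<Rightarrow>\<^sub>0 'b"
  assume "g \<in> {gen (w[k := (i, sc a x + sc b y)]) - fscale a (gen (w[k := (i, x)])) - fscale b (gen (w[k := (i, y)]))
    | w k i a b x y. w \<in> words V \<and> k < length w \<and> x \<in> V i \<and> y \<in> V i}"
  then obtain w k i a b x y where *: "w \<in> words V" "k < length w" "x \<in> V i" "y \<in> V i"
    and g: "g = gen (w[k := (i, sc a x + sc b y)]) - fscale a (gen (w[k := (i, x)])) - fscale b (gen (w[k := (i, y)]))"
    by blast
  let ?h = "\<lambda>j z. gen (take j (w[k := (i, z)]), drop j (w[k := (i, z)])) :: _ \<Rightarrow>\<^sub>0 'b"
  have "lin_ext (\<lambda>w. \<Sum>k\<in>{1..<length w}. gen (take k w, drop k w)) g =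
     (\<Sum>j\<in>{1..<length w}. ?h j (sc a x + sc b y) - fscale a (?h j x) - fscale b (?h j y))"
    by (simp add: g lin_ext_linear free.scale_sum_right sum_subtractf)
  also have "\<dots> \<in> tnull2 sc V"
    unfolding tnull2_def
  proof (rule free.span_sum, fold tnull2_def)
    fix j assume j: "j \<in> {1..<length w}"
    have tk: "take j w \<in> words V" and dr: "drop j w \<in> words V"
      using *(1) j by (auto simp: words_def dest: in_set_takeD in_set_dropD)
    show "?h j (sc a x + sc b y) - fscale a (?h j x) - fscale b (?h j y) \<in> tnull2 sc V"
    proof (cases "k < j")
      case True
      let ?n = "gen ((take j w)[k := (i, sc a x + sc b y)]) - fscale a (gen ((take j w)[k := (i, x)]))
         - fscale b (gen ((take j w)[k := (i, y)]))"
      have "?n \<in> tnull sc V" using tk *(3,4) True j by (intro tnull_gen) auto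
      moreover have "gen (drop j w) \<in> tbar V" using dr by (simp add: tbar_def gen_def)
      ultimately have "otimes ?n (gen (drop j w)) \<in> tnull2 sc V"
        unfolding tnull2_def by (intro free.span_base) blast
      moreover have "?h j (sc a x + sc b y) - fscale a (?h j x) - fscale b (?h j y) = otimes ?n (gen (drop j w))"
        using True by (simp add: otimes_def lin_ext_linear take_update_swap)
      ultimately show ?thesis by simp
    next
      case False
      let ?n = "gen ((drop j w)[k - j := (i, sc a x + sc b y)]) - fscale a (gen ((drop j w)[k - j := (i, x)]))
         - fscale b (gen ((drop j w)[k - j := (i, y)]))"
      have "?n \<in> tnull sc V" using dr *(2,3,4) False j by (intro tnull_gen) auto
      moreover have "gen (take j w) \<in> tbar V" using tk by (simp add: tbar_def gen_def)
      ultimately have "otimes (gen (take j w)) ?n \<in> tnull2 sc V"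
        unfolding tnull2_def by (intro free.span_base) blast
      moreover have "?h j (sc a x + sc b y) - fscale a (?h j x) - fscale b (?h j y) = otimes (gen (take j w)) ?n"
        using False by (simp add: otimes_def lin_ext_linear drop_update_swap)
      ultimately show ?thesis by simp
    qed
  qed
  finally show "lin_ext (\<lambda>w. \<Sum>k\<in>{1..<length w}. gen (take k w, drop k w)) g \<in> tnull2 sc V" .
qed




lemma shuffle_words_two:
  "shuffle_words [(i, x)] [(j, y)] =
     gen [(i, x), (j, y)] + fscale ((-1) powi (i * j)) (gen [(j, y), (i, x)])"
proof -
  have "\<sigma> permutes {..<2} \<longleftrightarrow> \<sigma> = id \<or> \<sigma> = Transposition.transpose 0 1" for \<sigma> :: "nat \<Rightarrow> nat"
  proof -
    have "{..<2} = {0, 1::nat}" by auto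
    then show ?thesis by (simp only: permutes_doubleton_iff)
  qed
  then have S: "shuffle_perms (Suc 0) (Suc (Suc 0)) = {id, Transposition.transpose 0 (Suc 0)}"
    unfolding shuffle_perms_def by (auto simp: numeral_2_eq_2)
  have 1: "{(i, j). i < j \<and> j < Suc (Suc 0) \<and> Transposition.transpose 0 (Suc 0) j < Transposition.transpose 0 (Suc 0) i} = {(0, Suc 0)}"
    by (auto simp: Transposition.transpose_def less_Suc_eq)
  have 2: "{(i, j). i < j \<and> j < Suc (Suc 0) \<and> id j < (id i :: nat)} = {}" by auto
  have 3: "id \<noteq> Transposition.transpose 0 (Suc 0)" by (metis id_apply transpose_apply_first zero_neq_one One_nat_def)
  have 4: "koszul_sign id [(i, x), (j, y)] = (1 :: 'b)" unfolding koszul_sign_def by (simp only: list.size add_0 add_Suc_right add_0_right 2) simp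
  have 5: "koszul_sign (Transposition.transpose 0 (Suc 0)) [(i, x), (j, y)] = ((-1) powi (i * j) :: 'b)"
    unfolding koszul_sign_def by (simp only: list.size add_0 add_Suc_right add_0_right 1) simp
  have 6: "permute_word id [(i, x), (j, y)] = [(i, x), (j, y)]"
    "permute_word (Transposition.transpose 0 (Suc 0)) [(i, x), (j, y)] = [(j, y), (i, x)]"
    by (simp_all add: permute_word_def)
  show ?thesis
    unfolding shuffle_words_def by (simp add: S 3 4 5 6)
qed

end

theory Submission
  imports Defs
begin

text \<open>
  A coalgebra morphism \<open>F\<close> is multiplicative for the shuffle product as soon as its Taylor
  coefficients vanish on shuffles of nonempty words, so this vanishing is what has to be proved; it
  goes by induction on the total number \<open>n\<close> of letters of the two words \<open>u\<close> and \<open>v\<close>.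

  By linearity the first letter of \<open>u\<close> lies in \<open>X\<close> or in \<open>Y\<close>.  If it lies in \<open>X\<close>, every word of the
  shuffle contains it and the hypothesis on \<open>F\<close> applies.  If it is \<open>y = Q\<^sub>1 x\<close> with \<open>x\<close> in \<open>X\<close>, write
  \<open>u = y u'\<close> and compare with the words \<open>x u'\<close> and \<open>v\<close>.  Since \<open>Q\<close> is a coderivation,
  \<open>Q (x u') = y u' + A + x B\<close>, where \<open>A\<close> is made of shorter words (\<open>coderivation_Cons\<close>); since \<open>Q\<close> is
  a derivation for shuffles, \<open>Q (x u' \<circledast> v)\<close> is the sum of \<open>y u' \<circledast> v\<close>, of \<open>A \<circledast> v\<close>, and of shuffles
  all of whose words contain \<open>x\<close>.  The Taylor coefficients of \<open>F\<close> vanish on \<open>A \<circledast> v\<close> by induction and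
  on the last summands by hypothesis.  Hence the value on \<open>y u' \<circledast> v\<close> is the linear part of
  \<open>F (Q (x u' \<circledast> v)) = R (F (x u' \<circledast> v))\<close>.  Now \<open>F\<close> is multiplicative on \<open>x u' \<circledast> v\<close>: this only needs
  the vanishing on shuffles with fewer letters and on \<open>x u' \<circledast> v\<close> itself.  So the right-hand side is
  \<open>R (F (x u') \<circledast> F v)\<close>, a sum of shuffles because \<open>R\<close> is a derivation, and it has no linear part.
  This is \<open>cogen_shuffle_boundary\<close>.

  Everything else supports the two facts about coalgebras used here.  The basic tool is a linear map
  \<open>join\<close> that glues \<open>a \<otimes> w\<close> to \<open>a w\<close> when \<open>a\<close> is a single letter and kills all other \<open>u \<otimes> w\<close>.  It
  respects the multilinearity relations, and it recovers an element from its coproduct, up to the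
  linear part.  Applied to the equations that define coderivations and coalgebra morphisms, it turns
  them into recursions that split off the first letter; for \<open>F\<close> the solution is the explicit map
  \<open>coext\<close> built from its Taylor coefficients (\<open>coalgebra_morphism_coext\<close>).  Multiplicativity is then
  proved for \<open>coext\<close> by comparing the first-letter recursion of the shuffle product
  (\<open>shuffle_words_Cons\<close>) with the compatibility of shuffles and deconcatenation
  (\<open>splits_shuffle_words\<close>).
\<close>

section \<open>Linear maps out of free vector spaces\<close>

lemma lin_ext_zero [simp]: "lin_ext f 0 = 0"
  by (simp add: lin_ext_def)

lemma flinear_sum: "flinear f \<Longrightarrow> f (\<Sum>i\<in>I. t i) = (\<Sum>i\<in>I. f (t i))"
proof -
  assume "flinear f"
  then interpret f: Vector_Spaces.linear fscale fscale f unfolding flinear_def .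
  show ?thesis by (rule f.sum)
qed

lemma flinear_add: "flinear f \<Longrightarrow> f (s + t) = f s + f t"
proof -
  assume "flinear f"
  then interpret f: Vector_Spaces.linear fscale fscale f unfolding flinear_def .
  show ?thesis by (rule f.add)
qed

lemmas lin_ext_sum = flinear_sum [OF flinear_lin_ext]

lemma lin_ext_gen_id [simp]: "lin_ext gen t = t"
proof (rule poly_mapping_eqI)
  fix a
  have "Poly_Mapping.lookup (lin_ext gen t) a = (\<Sum>b\<in>Poly_Mapping.keys t. if b = a then Poly_Mapping.lookup t b else 0)"
    unfolding lin_ext_def lookup_sum by (rule sum.cong) (auto simp: gen_def lookup_single when_def)
  then show "Poly_Mapping.lookup (lin_ext gen t) a = Poly_Mapping.lookup t a"
    by (simp add: in_keys_iff)
qed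

lemma lin_ext_lin_ext: "lin_ext f (lin_ext g t) = lin_ext (\<lambda>a. lin_ext f (g a)) t"
proof -
  have "lin_ext f (lin_ext g t) = (\<Sum>a\<in>Poly_Mapping.keys t. lin_ext f (fscale (Poly_Mapping.lookup t a) (g a)))"
    by (subst lin_ext_def [of g]) (rule lin_ext_sum)
  then show ?thesis
    by (simp add: lin_ext_fscale lin_ext_def [of "\<lambda>a. lin_ext f (g a)"])
qed

lemma flinear_eq_lin_ext:
  assumes "flinear f" shows "f t = lin_ext (\<lambda>a. f (gen a)) t"
proof -
  have "f t = f (lin_ext gen t)" by simp
  also have "\<dots> = lin_ext (\<lambda>a. f (gen a)) t"
    unfolding lin_ext_def using assms by (simp add: flinear_sum flinear_fscale)
  finally show ?thesis .
qed

lemma lin_ext_cong: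
  "(\<And>a. a \<in> Poly_Mapping.keys t \<Longrightarrow> f a = g a) \<Longrightarrow> lin_ext f t = lin_ext g t"
  unfolding lin_ext_def by (auto intro: sum.cong)

lemma lin_ext_fun_zero [simp]: "lin_ext (\<lambda>a. 0) t = 0"
  by (simp add: lin_ext_def)

lemma lin_ext_fun_add: "lin_ext (\<lambda>a. f a + g a) t = lin_ext f t + lin_ext g t"
  by (simp add: lin_ext_def free.scale_right_distrib sum.distrib)

lemma lin_ext_fun_diff: "lin_ext (\<lambda>a. f a - g a) t = lin_ext f t - lin_ext g t"
  by (simp add: lin_ext_def free.scale_right_diff_distrib sum_subtractf)

lemma lin_ext_fun_fscale: "lin_ext (\<lambda>a. fscale c (f a)) t = fscale c (lin_ext f t)"
  by (simp add: lin_ext_def free.scale_sum_right mult.commute)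

lemma lin_ext_fun_sum: "lin_ext (\<lambda>a. \<Sum>i\<in>I. f i a) t = (\<Sum>i\<in>I. lin_ext (f i) t)"
  by (simp add: lin_ext_def free.scale_sum_right) (rule sum.swap)

lemma lin_ext_swap:
  "lin_ext (\<lambda>a. lin_ext (B a) t) s = lin_ext (\<lambda>b. lin_ext (\<lambda>a. B a b) s) t"
  by (simp add: lin_ext_def free.scale_sum_right mult.commute) (rule sum.swap)

lemma keys_gen [simp]: "Poly_Mapping.keys (gen a :: _ \<Rightarrow>\<^sub>0 'k::field_char_0) = {a}"
  by (simp add: gen_def)

lemma keys_fscale: "Poly_Mapping.keys (fscale c t) \<subseteq> Poly_Mapping.keys t"
  by (auto simp: in_keys_iff)

lemma keys_lin_ext: "Poly_Mapping.keys (lin_ext f t) \<subseteq> (\<Union>a\<in>Poly_Mapping.keys t. Poly_Mapping.keys (f a))"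
proof -
  have "Poly_Mapping.keys (lin_ext f t) \<subseteq> (\<Union>a\<in>Poly_Mapping.keys t. Poly_Mapping.keys (fscale (Poly_Mapping.lookup t a) (f a)))"
    unfolding lin_ext_def by (rule keys_sum)
  also have "\<dots> \<subseteq> (\<Union>a\<in>Poly_Mapping.keys t. Poly_Mapping.keys (f a))"
    by (rule UN_mono [OF order_refl keys_fscale])
  finally show ?thesis .
qed

lemma lin_ext_in_span:
  "(\<And>a. a \<in> Poly_Mapping.keys t \<Longrightarrow> f a \<in> module.span fscale C) \<Longrightarrow> lin_ext f t \<in> module.span fscale C"
  unfolding lin_ext_def by (intro free.span_sum free.span_scale)

lemma flinear_comp_lin_ext: "flinear f \<Longrightarrow> f (lin_ext g t) = lin_ext (\<lambda>a. f (g a)) t"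
  by (subst flinear_eq_lin_ext [of f]) (simp_all add: lin_ext_lin_ext flinear_eq_lin_ext [of f "g _", symmetric])

lemma keys_lin_extE:
  assumes "x \<in> Poly_Mapping.keys (lin_ext f t)"
  obtains a where "a \<in> Poly_Mapping.keys t" "x \<in> Poly_Mapping.keys (f a)"
  using subsetD [OF keys_lin_ext assms] by blast

section \<open>The first-letter recursion of the shuffle product\<close>

text \<open>
  The shuffles of two nonempty words are of two kinds, according to which of the two first letters
  comes first in the result.  Both kinds arise from a shuffle of one letter less, by inserting a
  position \<open>q\<close> and sending it to the front: \<open>q = 0\<close> is the first letter of the first word, and the
  length of the first word gives \<open>q\<close> for the first letter of the second one.
\<close>

definition insert_first :: "nat \<Rightarrow> (nat \<Rightarrow> nat) \<Rightarrow> nat \<Rightarrow> nat" where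
  "insert_first q \<tau> i = (if i < q then Suc (\<tau> i) else if i = q then 0 else Suc (\<tau> (i - 1)))"

text \<open>
  The order embedding of the old positions into the new ones; its range misses exactly \<open>q\<close>, so a
  statement about \<open>insert_first q \<tau>\<close> splits into the position \<open>q\<close> and the values \<open>skip q i\<close>.
\<close>

definition skip :: "nat \<Rightarrow> nat \<Rightarrow> nat" where
  "skip q i = (if i < q then i else Suc i)"

lemma insert_first_skip [simp]: "insert_first q \<tau> (skip q i) = Suc (\<tau> i)"
  by (auto simp: insert_first_def skip_def)

lemma insert_first_self [simp]: "insert_first q \<tau> q = 0"
  by (simp add: insert_first_def)

lemma skip_cases: obtains "i = q" | j where "i = skip q j"
proof (cases "i \<le> q")
  case True
  then have "i = q \<or> i = skip q i" by (simp add: skip_def)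
  then show ?thesis using that by blast
next
  case False
  then have "i = skip q (i - 1)" by (auto simp: skip_def)
  then show ?thesis using that by blast
qed

lemma skip_neq [simp]: "skip q i \<noteq> q" "q \<noteq> skip q i"
  by (auto simp: skip_def)

lemma skip_less_iff [simp]: "skip q i < skip q j \<longleftrightarrow> i < j"
  by (auto simp: skip_def)

lemma skip_eq_iff [simp]: "skip q i = skip q j \<longleftrightarrow> i = j"
  by (auto simp: skip_def)

lemma skip_less_Suc: "q \<le> n \<Longrightarrow> skip q i < Suc n \<longleftrightarrow> i < n"
  by (auto simp: skip_def)

lemma insert_first_permutes:
  assumes "\<tau> permutes {..<n}" "q \<le> n"
  shows "insert_first q \<tau> permutes {..<Suc n}"
proof (rule bij_imp_permutes)
  have inj: "inj \<tau>" using assms(1) by (rule permutes_inj)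
  have 1: "inj (insert_first q \<tau>)"
  proof (rule injI)
    fix i j assume "insert_first q \<tau> i = insert_first q \<tau> j"
    then show "i = j"
      by (cases i q rule: skip_cases; cases j q rule: skip_cases) (auto dest: injD [OF inj])
  qed
  have 2: "insert_first q \<tau> ` {..<Suc n} \<subseteq> {..<Suc n}"
  proof clarsimp
    fix i assume "i < Suc n"
    then show "insert_first q \<tau> i < Suc n"
      using permutes_in_image[OF assms(1)] assms(2)
      by (cases i q rule: skip_cases) (auto simp: skip_less_Suc)
  qed
  show "bij_betw (insert_first q \<tau>) {..<Suc n} {..<Suc n}"
    by (rule bij_betw_imageI [OF inj_on_subset [OF 1]])
       (use endo_inj_surj[OF _ 2] inj_on_subset [OF 1] in auto)
next
  fix i assume "i \<notin> {..<Suc n}"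
  then have "\<not> i < q" "i \<noteq> q" "i - 1 \<notin> {..<n}" "Suc (i - 1) = i" using assms(2) by auto
  then show "insert_first q \<tau> i = i"
    using permutes_not_in[OF assms(1)] by (simp add: insert_first_def)
qed

lemma insert_first_inject:
  assumes "insert_first q \<tau> = insert_first q \<tau>'" shows "\<tau> = \<tau>'"
proof
  fix i
  have "insert_first q \<tau> (skip q i) = insert_first q \<tau>' (skip q i)" using assms by simp
  then show "\<tau> i = \<tau>' i" by simp
qed

lemma permutes_as_insert_first:
  assumes "\<sigma> permutes {..<Suc n}" "\<sigma> q = 0" "q \<le> n"
  obtains \<tau> where "\<tau> permutes {..<n}" "\<sigma> = insert_first q \<tau>"
proof -
  define \<tau> where "\<tau> i = \<sigma> (skip q i) - 1" for i
  have inj: "inj \<sigma>" using assms(1) by (rule permutes_inj)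
  have pos: "\<sigma> (skip q i) = Suc (\<tau> i)" for i
  proof -
    have "\<sigma> (skip q i) \<noteq> \<sigma> q" using inj by (simp add: inj_eq)
    then show ?thesis using assms(2) by (simp add: \<tau>_def)
  qed
  have eq: "\<sigma> = insert_first q \<tau>"
  proof
    fix i show "\<sigma> i = insert_first q \<tau> i"
      by (cases i q rule: skip_cases) (auto simp: assms(2) pos)
  qed
  have "\<tau> permutes {..<n}"
  proof (rule bij_imp_permutes)
    have 1: "inj \<tau>"
    proof (rule injI)
      fix i j assume "\<tau> i = \<tau> j"
      then have "\<sigma> (skip q i) = \<sigma> (skip q j)" by (simp add: pos)
      then show "i = j" using inj by (simp add: inj_eq)
    qed
    have 2: "\<tau> ` {..<n} \<subseteq> {..<n}"
    proof clarsimp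
      fix i assume "i < n"
      then have "\<sigma> (skip q i) < Suc n"
        using permutes_in_image[OF assms(1), of "skip q i"] assms(3) by (simp add: skip_less_Suc)
      then show "\<tau> i < n" by (simp add: pos)
    qed
    show "bij_betw \<tau> {..<n} {..<n}"
      by (rule bij_betw_imageI [OF inj_on_subset [OF 1]])
         (use endo_inj_surj[OF _ 2] inj_on_subset [OF 1] in auto)
  next
    fix i assume "i \<notin> {..<n}"
    then have "skip q i \<notin> {..<Suc n}" "skip q i = Suc i" using assms(3) by (auto simp: skip_def)
    then show "\<tau> i = i" using permutes_not_in[OF assms(1)] by (simp add: \<tau>_def)
  qed
  with eq show ?thesis using that by blast
qed

lemma nth_insert_skip:
  "q \<le> length w \<Longrightarrow> i < length w \<Longrightarrow> (take q w @ l # drop q w) ! skip q i = w ! i"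
  by (auto simp: skip_def nth_append min_def)

lemma permute_word_insert_first:
  assumes "\<tau> permutes {..<length w}" "q \<le> length w"
  shows "permute_word (insert_first q \<tau>) (take q w @ l # drop q w) = l # permute_word \<tau> w"
proof (rule nth_equalityI)
  show "length (permute_word (insert_first q \<tau>) (take q w @ l # drop q w)) = length (l # permute_word \<tau> w)"
    using assms(2) by (simp add: permute_word_def)
next
  note p = insert_first_permutes [OF assms]
  fix j assume "j < length (permute_word (insert_first q \<tau>) (take q w @ l # drop q w))"
  then have j: "j < Suc (length w)" using assms(2) by (simp add: permute_word_def)
  show "permute_word (insert_first q \<tau>) (take q w @ l # drop q w) ! j = (l # permute_word \<tau> w) ! j"
  proof (cases j)
    case 0
    have "inv (insert_first q \<tau>) 0 = q" using permutes_inv_eq[OF p, of 0 q] by simp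
    then show ?thesis using 0 assms(2) by (auto simp: permute_word_def nth_append)
  next
    case (Suc m)
    have m: "inv \<tau> m < length w" using permutes_in_image[OF permutes_inv[OF assms(1)], of m] j Suc by simp
    have "insert_first q \<tau> (skip q (inv \<tau> m)) = Suc m"
      using permutes_inverses(1)[OF assms(1)] by simp
    then have "inv (insert_first q \<tau>) (Suc m) = skip q (inv \<tau> m)" using permutes_inv_eq[OF p] by simp
    then show ?thesis using Suc j m assms(2) nth_insert_skip[OF assms(2) m, of l]
      by (simp add: permute_word_def del: upt_Suc)
  qed
qed

lemma powi_minus_one_add: "(-1 :: 'k::field_char_0) powi (m + n) = (-1) powi m * (-1) powi n"
  by (rule power_int_add) simp

lemma wdeg_simps [simp]: "wdeg [] = 0" "wdeg (l # w) = fst l + wdeg w" "wdeg (u @ v) = wdeg u + wdeg v"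
  by (simp_all add: wdeg_def)

lemma prod_sign_take:
  "q \<le> length w \<Longrightarrow> (\<Prod>i<q. (-1 :: 'k::field_char_0) powi (fst (w ! i) * d)) = (-1) powi (d * wdeg (take q w))"
  by (induction q)
     (simp_all add: take_Suc_conv_app_nth distrib_left powi_minus_one_add mult.commute)

text \<open>
  The inversions of the larger permutation are those of \<open>\<tau>\<close> and the pairs of the inserted letter
  with each of the \<open>q\<close> letters that it overtakes.
\<close>

lemma koszul_sign_insert_first:
  assumes "q \<le> length w"
  shows "(koszul_sign (insert_first q \<tau>) (take q w @ l # drop q w) :: 'k::field_char_0) =
     (-1) powi (fst l * wdeg (take q w)) * koszul_sign \<tau> w"
proof -
  let ?w = "take q w @ l # drop q w"
  let ?I = "{(i, j). i < j \<and> j < length w \<and> \<tau> j < \<tau> i}"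
  let ?f = "\<lambda>(i, j). (-1 :: 'k) powi (fst (?w ! i) * fst (?w ! j))"
  let ?s = "map_prod (skip q) (skip q)"
  have set: "{(i, j). i < j \<and> j < length ?w \<and> insert_first q \<tau> j < insert_first q \<tau> i} =
     (\<lambda>i. (i, q)) ` {..<q} \<union> ?s ` ?I" (is "?A = ?B")
  proof (rule set_eqI, clarify)
    fix i j
    show "(i, j) \<in> ?A \<longleftrightarrow> (i, j) \<in> ?B"
      using assms
    proof (cases i q rule: skip_cases; cases j q rule: skip_cases)
      fix j' assume "i = q" "j = skip q j'"
      then show ?thesis by auto
    next
      fix i' assume i: "i = skip q i'" and "j = q"
      then show ?thesis using assms by (auto simp: image_iff)
    next
      fix i' j' assume "i = skip q i'" "j = skip q j'"
      then show ?thesis using assms by (auto simp: image_iff skip_less_Suc)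
    qed auto
  qed
  have fin: "finite ?I" by (rule finite_subset [of _ "{..<length w} \<times> {..<length w}"]) auto
  have "koszul_sign (insert_first q \<tau>) ?w = prod ?f ?B" unfolding koszul_sign_def set ..
  also have "\<dots> = prod ?f ((\<lambda>i. (i, q)) ` {..<q}) * prod ?f (?s ` ?I)"
    by (rule prod.union_disjoint) (use fin in auto)
  also have "prod ?f ((\<lambda>i. (i, q)) ` {..<q}) = (\<Prod>i<q. (-1) powi (fst (w ! i) * fst l))"
    using assms by (subst prod.reindex) (auto simp: inj_on_def nth_append intro!: prod.cong)
  also have "prod ?f (?s ` ?I) = koszul_sign \<tau> w"
    unfolding koszul_sign_def using nth_insert_skip [OF assms, of _ l]
    by (subst prod.reindex) (auto simp: inj_on_def intro!: prod.cong)
  finally show ?thesis by (simp add: prod_sign_take [OF assms])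
qed

text \<open>
  The position sent to the front must be \<open>0\<close> or \<open>p\<close>: the predecessor of any other position is sent
  to something smaller.
\<close>

lemma shuffle_perms_first:
  assumes "0 < p" "p \<le> n"
  shows "shuffle_perms p (Suc n) =
    insert_first 0 ` shuffle_perms (p - 1) n \<union> insert_first p ` shuffle_perms p n"
proof (rule set_eqI, rule iffI)
  fix \<sigma> assume s: "\<sigma> \<in> shuffle_perms p (Suc n)"
  then have perm: "\<sigma> permutes {..<Suc n}"
    and inc: "\<And>i. i < n \<Longrightarrow> Suc i \<noteq> p \<Longrightarrow> \<sigma> i < \<sigma> (Suc i)"
    by (auto simp: shuffle_perms_def)
  define q where "q = inv \<sigma> 0"
  have q0: "\<sigma> q = 0" using permutes_inverses(1)[OF perm] by (simp add: q_def)
  have qn: "q \<le> n" using permutes_in_image[OF perm, of q] q0 by simp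
  have "q = 0 \<or> q = p"
    using inc[of "q - 1"] q0 qn by (cases q) auto
  moreover obtain \<tau> where t: "\<tau> permutes {..<n}" and eq: "\<sigma> = insert_first q \<tau>"
    using permutes_as_insert_first [OF perm q0 qn] by blast
  ultimately show "\<sigma> \<in> insert_first 0 ` shuffle_perms (p - 1) n \<union> insert_first p ` shuffle_perms p n"
  proof (elim disjE)
    assume q: "q = 0"
    have "\<tau> i < \<tau> (Suc i)" if "Suc i < n" "Suc i \<noteq> p - 1" for i
      using inc[of "Suc i"] that eq q by (auto simp: insert_first_def)
    then have "\<tau> \<in> shuffle_perms (p - 1) n" using t by (simp add: shuffle_perms_def)
    then show ?thesis using eq q by blast
  next
    assume q: "q = p"
    have "\<tau> i < \<tau> (Suc i)" if "Suc i < n" "Suc i \<noteq> p" for i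
      using inc[of i] inc[of "Suc i"] that eq q by (auto simp: insert_first_def split: if_splits)
    then have "\<tau> \<in> shuffle_perms p n" using t by (simp add: shuffle_perms_def)
    then show ?thesis using eq q by blast
  qed
next
  fix \<sigma> assume "\<sigma> \<in> insert_first 0 ` shuffle_perms (p - 1) n \<union> insert_first p ` shuffle_perms p n"
  then show "\<sigma> \<in> shuffle_perms p (Suc n)"
  proof (elim UnE imageE)
    fix \<tau> assume eq: "\<sigma> = insert_first 0 \<tau>" and t: "\<tau> \<in> shuffle_perms (p - 1) n"
    show ?thesis
      unfolding shuffle_perms_def
    proof (intro CollectI conjI allI impI)
      show "\<sigma> permutes {..<Suc n}" using t eq insert_first_permutes by (auto simp: shuffle_perms_def)
      fix i assume i: "i + 1 < Suc n \<and> i + 1 \<noteq> p"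
      show "\<sigma> i < \<sigma> (i + 1)"
        using i t assms by (cases i) (auto simp: eq insert_first_def shuffle_perms_def)
    qed
  next
    fix \<tau> assume eq: "\<sigma> = insert_first p \<tau>" and t: "\<tau> \<in> shuffle_perms p n"
    show ?thesis
      unfolding shuffle_perms_def
    proof (intro CollectI conjI allI impI)
      show "\<sigma> permutes {..<Suc n}" using t eq insert_first_permutes assms by (auto simp: shuffle_perms_def)
      fix i assume i: "i + 1 < Suc n \<and> i + 1 \<noteq> p"
      have t': "\<And>i. Suc i < n \<Longrightarrow> Suc i \<noteq> p \<Longrightarrow> \<tau> i < \<tau> (Suc i)"
        using t by (auto simp: shuffle_perms_def)
      show "\<sigma> i < \<sigma> (i + 1)"
        using i t'[of i] t'[of "i - 1"] assms by (auto simp: eq insert_first_def)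
    qed
  qed
qed

definition prepend :: "int \<times> 'v \<Rightarrow> ('v word \<Rightarrow>\<^sub>0 'k::field_char_0) \<Rightarrow> ('v word \<Rightarrow>\<^sub>0 'k)" where
  "prepend l = lin_ext (\<lambda>w. gen (l # w))"

lemma prepend_gen [simp]: "prepend l (gen w) = gen (l # w)"
  by (simp add: prepend_def)

lemma flinear_prepend: "flinear (prepend l)"
  unfolding prepend_def by (rule flinear_lin_ext)

lemma finite_shuffle_perms [simp]: "finite (shuffle_perms p n)"
  by (rule finite_subset [OF _ finite_permutations [of "{..<n}"]]) (auto simp: shuffle_perms_def)

lemma shuffle_words_Cons:
  "(shuffle_words (a # u) (b # v) :: _ \<Rightarrow>\<^sub>0 'k::field_char_0) =
     prepend a (shuffle_words u (b # v)) +
     fscale ((-1) powi (fst b * wdeg (a # u))) (prepend b (shuffle_words (a # u) v))"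
proof -
  let ?p = "length (a # u)" and ?n = "length (u @ b # v)"
  let ?t = "\<lambda>w \<sigma>. fscale (koszul_sign \<sigma> w) (gen (permute_word \<sigma> w)) :: _ \<Rightarrow>\<^sub>0 'k"
  have n: "length ((a # u) @ v) = ?n" by simp
  have dis: "insert_first 0 ` shuffle_perms (?p - 1) ?n \<inter> insert_first ?p ` shuffle_perms ?p ?n = {}"
  proof -
    have "insert_first 0 \<tau> \<noteq> insert_first ?p \<tau>'" for \<tau> \<tau>'
    proof
      assume "insert_first 0 \<tau> = insert_first ?p \<tau>'"
      then have "insert_first 0 \<tau> 0 = insert_first ?p \<tau>' 0" by metis
      then show False by (simp add: insert_first_def)
    qed
    then show ?thesis by auto
  qed
  have inj: "inj_on (insert_first q) A" for q A by (meson inj_onI insert_first_inject)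
  have "shuffle_words (a # u) (b # v) = (\<Sum>\<sigma>\<in>shuffle_perms ?p (Suc ?n). ?t (a # u @ b # v) \<sigma>)"
    by (simp add: shuffle_words_def)
  also have "\<dots> = (\<Sum>\<sigma>\<in>insert_first 0 ` shuffle_perms (?p - 1) ?n. ?t (a # u @ b # v) \<sigma>) +
     (\<Sum>\<sigma>\<in>insert_first ?p ` shuffle_perms ?p ?n. ?t (a # u @ b # v) \<sigma>)"
    by (subst shuffle_perms_first) (simp, simp, rule sum.union_disjoint [OF _ _ dis], simp_all)
  also have "(\<Sum>\<sigma>\<in>insert_first 0 ` shuffle_perms (?p - 1) ?n. ?t (a # u @ b # v) \<sigma>) =
     (\<Sum>\<tau>\<in>shuffle_perms (?p - 1) ?n. prepend a (?t (u @ b # v) \<tau>))"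
    unfolding sum.reindex [OF inj] o_def
  proof (rule sum.cong [OF refl])
    fix \<tau> assume "\<tau> \<in> shuffle_perms (?p - 1) ?n"
    then have "\<tau> permutes {..<?n}" by (simp add: shuffle_perms_def)
    from permute_word_insert_first [OF this, of 0 a] koszul_sign_insert_first [of 0 "u @ b # v" \<tau> a, where 'k = 'k]
    show "?t (a # u @ b # v) (insert_first 0 \<tau>) = prepend a (?t (u @ b # v) \<tau>)"
      by (simp add: flinear_fscale [OF flinear_prepend])
  qed
  also have "\<dots> = prepend a (shuffle_words u (b # v))"
    by (simp add: shuffle_words_def flinear_sum [OF flinear_prepend])
  also have "(\<Sum>\<sigma>\<in>insert_first ?p ` shuffle_perms ?p ?n. ?t (a # u @ b # v) \<sigma>) =
     (\<Sum>\<tau>\<in>shuffle_perms ?p ?n. fscale ((-1) powi (fst b * wdeg (a # u))) (prepend b (?t ((a # u) @ v) \<tau>)))"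
    unfolding sum.reindex [OF inj] o_def
  proof (rule sum.cong [OF refl])
    fix \<tau> assume "\<tau> \<in> shuffle_perms ?p ?n"
    then have "\<tau> permutes {..<length ((a # u) @ v)}" by (simp add: shuffle_perms_def)
    from permute_word_insert_first [OF this, of ?p b] koszul_sign_insert_first [of ?p "(a # u) @ v" \<tau> b, where 'k = 'k]
    show "?t (a # u @ b # v) (insert_first ?p \<tau>) =
       fscale ((-1) powi (fst b * wdeg (a # u))) (prepend b (?t ((a # u) @ v) \<tau>))"
      by (simp add: flinear_fscale [OF flinear_prepend])
  qed
  also have "\<dots> = fscale ((-1) powi (fst b * wdeg (a # u))) (prepend b (shuffle_words (a # u) v))"
    unfolding shuffle_words_def flinear_sum [OF flinear_prepend] free.scale_sum_right by simp
  finally show ?thesis .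
qed

text \<open>
  A shuffle with the empty word has no descent, hence is the identity.  So the empty word is the
  unit of the product, which lets the reduced and the unreduced tensor algebra be treated together.
\<close>

lemma shuffle_words_trivial:
  assumes "u = [] \<or> v = []"
  shows "shuffle_words u v = gen (u @ v)"
proof -
  have mono: "\<sigma> = id" if p: "\<sigma> permutes {..<n}" and i: "\<And>i. Suc i < n \<Longrightarrow> \<sigma> i < \<sigma> (Suc i)" for \<sigma> n
  proof -
    have le: "i \<le> \<sigma> i" if "i < n" for i
      using that
    proof (induction i)
      case (Suc m) then show ?case using i[of m] by simp
    qed simp
    have "\<sigma> i = i" for i
    proof (cases "i < n")
      case True
      have "\<sigma> i < n" using permutes_in_image[OF p, of i] True by simp
      have ge: "\<sigma> (n - Suc m) \<le> n - Suc m" if "m < n" for m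
        using that
      proof (induction m)
        case 0
        then show ?case using permutes_in_image[OF p, of "n - 1"] by simp
      next
        case (Suc m) then show ?case using i[of "n - Suc (Suc m)"] by (simp add: Suc_diff_Suc)
      qed
      from ge[of "n - Suc i"] le[OF True] True show ?thesis by simp
    next
      case False then show ?thesis using permutes_not_in[OF p] by simp
    qed
    then show ?thesis by (auto simp: fun_eq_iff)
  qed
  have "shuffle_perms (length u) (length (u @ v)) = {id}"
    unfolding shuffle_perms_def using assms by (auto intro!: mono permutes_id)
  moreover have "koszul_sign id (u @ v) = (1 :: 'b)"
  proof -
    have "{(i, j). i < j \<and> j < length (u @ v) \<and> id j < (id i :: nat)} = {}" by auto
    then show ?thesis unfolding koszul_sign_def by (simp only:) simp
  qed
  moreover have "permute_word id (u @ v) = u @ v"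
    unfolding permute_word_def by (simp only: inv_id id_apply map_nth)
  ultimately show ?thesis by (simp add: shuffle_words_def)
qed

lemma shuffle_words_Nil [simp]: "shuffle_words [] v = gen v" "shuffle_words u [] = gen u"
  by (simp_all add: shuffle_words_trivial)

section \<open>Deconcatenating a shuffle\<close>

abbreviation ksgn :: "int \<Rightarrow> 'k::field_char_0" where
  "ksgn n \<equiv> (-1) powi n"

text \<open>
  The unreduced coproduct, with the two extreme terms that involve the empty word.
\<close>

definition splits :: "'v word \<Rightarrow> ('v word \<times> 'v word \<Rightarrow>\<^sub>0 'k::field_char_0)" where
  "splits w = (\<Sum>k\<le>length w. gen (take k w, drop k w))"

definition prepend_fst :: "int \<times> 'v \<Rightarrow> ('v word \<times> 'v word \<Rightarrow>\<^sub>0 'k::field_char_0) \<Rightarrow> ('v word \<times> 'v word \<Rightarrow>\<^sub>0 'k)" where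
  "prepend_fst a = lin_ext (\<lambda>(x, y). gen (a # x, y))"

lemma lin_ext_otimes: "lin_ext f (otimes s t) = lin_ext (\<lambda>a. lin_ext (\<lambda>b. f (a, b)) t) s"
  by (simp add: otimes_def lin_ext_lin_ext)

lemma otimes_gen_left: "otimes (gen a) t = lin_ext (\<lambda>b. gen (a, b)) t"
  by (simp add: otimes_def)

lemma otimes_add_right: "otimes s (t + t') = otimes s t + otimes s t'"
  by (simp add: otimes_def lin_ext_add lin_ext_fun_add)

lemma otimes_add_left: "otimes (s + s') t = otimes s t + otimes s' t"
  by (simp add: otimes_def lin_ext_add)

lemma otimes_fscale_left: "otimes (fscale c s) t = fscale c (otimes s t)"
  by (simp add: otimes_def lin_ext_fscale)

lemma otimes_fscale_right: "otimes s (fscale c t) = fscale c (otimes s t)"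
  by (simp add: otimes_def lin_ext_fscale lin_ext_fun_fscale)

lemma prepend_fst_otimes: "prepend_fst a (otimes s t) = otimes (prepend a s) t"
  by (simp add: prepend_fst_def lin_ext_otimes prepend_def) (simp add: otimes_def lin_ext_lin_ext)

lemma flinear_prepend_fst: "flinear (prepend_fst a)"
  unfolding prepend_fst_def by (rule flinear_lin_ext)

lemma splits_Cons: "splits (a # w) = gen ([], a # w) + prepend_fst a (splits w)"
proof -
  have "splits (a # w) = gen ([], a # w) + (\<Sum>k\<le>length w. gen (a # take k w, drop k w))"
    by (simp add: splits_def sum.atMost_Suc_shift del: sum.atMost_Suc)
  then show ?thesis by (simp add: splits_def flinear_sum [OF flinear_prepend_fst]) (simp add: prepend_fst_def)
qed

lemma splits_prepend:
  "lin_ext splits (prepend a t) = otimes (gen []) (prepend a t) + prepend_fst a (lin_ext splits t)"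
  by (simp add: prepend_def lin_ext_lin_ext splits_Cons lin_ext_fun_add otimes_gen_left prepend_fst_def)

text \<open>
  Shuffles and deconcatenation form a bialgebra: cutting a shuffle of \<open>u\<close> and \<open>v\<close> amounts to cutting
  \<open>u\<close> and \<open>v\<close> and shuffling the left parts and the right parts.  The sign comes from moving the left
  part of \<open>v\<close> past the right part of \<open>u\<close>.
\<close>

lemma splits_shuffle_words:
  "lin_ext splits (shuffle_words u v) =
     (\<Sum>k\<le>length u. \<Sum>l\<le>length v. fscale (ksgn (wdeg (drop k u) * wdeg (take l v)))
        (otimes (shuffle_words (take k u) (take l v)) (shuffle_words (drop k u) (drop l v))))"
proof (induction u arbitrary: v)
  case Nil
  then show ?case by (simp add: splits_def)
next
  case (Cons a u)
  note IHu = Cons.IH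
  show ?case
  proof (induction v)
    case Nil
    have [simp]: "power_int (-1 :: 'b) (i * 0) = 1" for i by simp
    show ?case by (simp add: splits_def del: sum.atMost_Suc)
  next
    case (Cons b v)
    let ?s = "ksgn (fst b * wdeg (a # u)) :: 'b"
    \<comment> \<open>\<open>?T\<close> is the claimed summand; by the first-letter recursion it is a summand \<open>?A\<close>, whose left part
      begins with \<open>a\<close>, plus a summand \<open>?B\<close>, whose left part begins with \<open>b\<close>, whenever both exist.\<close>
    let ?A = "\<lambda>k l. fscale (ksgn (wdeg (drop k u) * wdeg (take l (b # v))))
        (otimes (prepend a (shuffle_words (take k u) (take l (b # v))))
           (shuffle_words (drop k u) (drop l (b # v)))) :: _ \<Rightarrow>\<^sub>0 'b"
    let ?B = "\<lambda>k l. fscale ?s (fscale (ksgn (wdeg (drop k (a # u)) * wdeg (take l v)))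
        (otimes (prepend b (shuffle_words (take k (a # u)) (take l v)))
           (shuffle_words (drop k (a # u)) (drop l v)))) :: _ \<Rightarrow>\<^sub>0 'b"
    let ?T = "\<lambda>k l. fscale (ksgn (wdeg (drop k (a # u)) * wdeg (take l (b # v))))
        (otimes (shuffle_words (take k (a # u)) (take l (b # v)))
           (shuffle_words (drop k (a # u)) (drop l (b # v)))) :: _ \<Rightarrow>\<^sub>0 'b"
    have A: "prepend_fst a (lin_ext splits (shuffle_words u (b # v))) =
        (\<Sum>k\<le>length u. \<Sum>l\<le>Suc (length v). ?A k l)"
      unfolding IHu by (simp only: flinear_sum [OF flinear_prepend_fst] flinear_fscale [OF flinear_prepend_fst]
          prepend_fst_otimes list.size add_0_right add_Suc_right)
    have B: "fscale ?s (prepend_fst b (lin_ext splits (shuffle_words (a # u) v))) =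
        (\<Sum>k\<le>Suc (length u). \<Sum>l\<le>length v. ?B k l)"
      unfolding Cons.IH by (simp only: flinear_sum [OF flinear_prepend_fst] flinear_fscale [OF flinear_prepend_fst]
          prepend_fst_otimes list.size add_0_right add_Suc_right free.scale_sum_right)
    have "lin_ext splits (shuffle_words (a # u) (b # v)) =
        otimes (gen []) (shuffle_words (a # u) (b # v)) +
        (prepend_fst a (lin_ext splits (shuffle_words u (b # v))) +
         fscale ?s (prepend_fst b (lin_ext splits (shuffle_words (a # u) v))))"
      unfolding shuffle_words_Cons lin_ext_add lin_ext_fscale splits_prepend
      by (simp only: otimes_add_right otimes_fscale_right free.scale_right_distrib add_ac)
    also have "otimes (gen []) (shuffle_words (a # u) (b # v)) = ?T 0 0"
      by simp
    also have "prepend_fst a (lin_ext splits (shuffle_words u (b # v))) +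
         fscale ?s (prepend_fst b (lin_ext splits (shuffle_words (a # u) v))) =
        ((\<Sum>k\<le>length u. ?A k 0) + (\<Sum>k\<le>length u. \<Sum>l\<le>length v. ?A k (Suc l))) +
        ((\<Sum>l\<le>length v. ?B 0 l) + (\<Sum>k\<le>length u. \<Sum>l\<le>length v. ?B (Suc k) l))"
      unfolding A B
      by (subst sum.atMost_Suc_shift [of "\<lambda>k. \<Sum>l\<le>length v. ?B k l"])
         (simp only: sum.atMost_Suc_shift [of "\<lambda>l. ?A _ l"] sum.distrib)
    also have "(\<Sum>k\<le>length u. ?A k 0) = (\<Sum>k\<le>length u. ?T (Suc k) 0)"
      by (rule sum.cong) simp_all
    also have "(\<Sum>l\<le>length v. ?B 0 l) = (\<Sum>l\<le>length v. ?T 0 (Suc l))"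
      by (rule sum.cong) (simp_all add: algebra_simps powi_minus_one_add)
    also have "?T 0 0 + (((\<Sum>k\<le>length u. ?T (Suc k) 0) + (\<Sum>k\<le>length u. \<Sum>l\<le>length v. ?A k (Suc l))) +
        ((\<Sum>l\<le>length v. ?T 0 (Suc l)) + (\<Sum>k\<le>length u. \<Sum>l\<le>length v. ?B (Suc k) l))) =
        (?T 0 0 + (\<Sum>l\<le>length v. ?T 0 (Suc l))) + ((\<Sum>k\<le>length u. ?T (Suc k) 0) +
        (\<Sum>k\<le>length u. \<Sum>l\<le>length v. ?A k (Suc l) + ?B (Suc k) l))"
      by (simp only: sum.distrib add_ac)
    also have "(\<Sum>k\<le>length u. \<Sum>l\<le>length v. ?A k (Suc l) + ?B (Suc k) l) =
        (\<Sum>k\<le>length u. \<Sum>l\<le>length v. ?T (Suc k) (Suc l))"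
    proof (intro sum.cong refl)
      fix k l
      have d: "wdeg u = wdeg (take k u) + wdeg (drop k u)"
        using wdeg_simps(3)[of "take k u" "drop k u"] by simp
      have e: "wdeg (drop k u) * (fst b + wdeg (take l v)) + fst b * (fst a + wdeg (take k u)) =
          fst b * (fst a + wdeg u) + wdeg (drop k u) * wdeg (take l v)"
        by (simp add: d algebra_simps)
      have sg: "(ksgn (wdeg (drop k u) * (fst b + wdeg (take l v))) :: 'b) * ksgn (fst b * (fst a + wdeg (take k u))) =
          ksgn (fst b * (fst a + wdeg u)) * ksgn (wdeg (drop k u) * wdeg (take l v))"
        by (simp only: powi_minus_one_add [symmetric] e)
      show "?A k (Suc l) + ?B (Suc k) l = ?T (Suc k) (Suc l)"
        by (simp only: take_Suc_Cons drop_Suc_Cons shuffle_words_Cons otimes_add_left otimes_fscale_left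
            free.scale_right_distrib wdeg_simps free.scale_scale sg)
    qed
    also have "(?T 0 0 + (\<Sum>l\<le>length v. ?T 0 (Suc l))) + ((\<Sum>k\<le>length u. ?T (Suc k) 0) +
        (\<Sum>k\<le>length u. \<Sum>l\<le>length v. ?T (Suc k) (Suc l))) =
        (\<Sum>k\<le>length (a # u). \<Sum>l\<le>length (b # v). ?T k l)"
      unfolding list.size add_0_right add_Suc_right
      by (subst sum.atMost_Suc_shift [of "\<lambda>k. \<Sum>l\<le>Suc (length v). ?T k l"])
         (simp only: sum.atMost_Suc_shift [of "\<lambda>l. ?T _ l"] sum.distrib)
    finally show ?case .
  qed
qed

text \<open>
  A shuffle only rearranges letters; the number, the set and the total degree of the letters are
  read off from this.
\<close>

lemma shuffle_words_keys:
  assumes "w \<in> Poly_Mapping.keys (shuffle_words u v :: _ \<Rightarrow>\<^sub>0 'k::field_char_0)"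
  shows "mset w = mset (u @ v)"
  using assms
proof (induction u arbitrary: v w)
  case Nil then show ?case by simp
next
  case (Cons a u)
  note IHu = Cons.IH
  from Cons.prems show ?case
  proof (induction v arbitrary: w)
    case Nil then show ?case by simp
  next
    case (Cons b v)
    have k: "Poly_Mapping.keys (prepend l t) \<subseteq> Cons l ` Poly_Mapping.keys t"
      for l and t :: "_ \<Rightarrow>\<^sub>0 'k"
      using keys_lin_ext[of "\<lambda>w. gen (l # w)" t] by (auto simp: prepend_def)
    have "w \<in> Cons a ` Poly_Mapping.keys (shuffle_words u (b # v) :: _ \<Rightarrow>\<^sub>0 'k) \<union>
       Cons b ` Poly_Mapping.keys (shuffle_words (a # u) v :: _ \<Rightarrow>\<^sub>0 'k)"
      using Cons.prems unfolding shuffle_words_Cons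
      by (rule rev_subsetD [OF _ subset_trans [OF Poly_Mapping.keys_add
            Un_mono [OF k subset_trans [OF keys_fscale k]]]])
    then show ?case
    proof (elim UnE imageE)
      fix x assume "w = a # x" "x \<in> Poly_Mapping.keys (shuffle_words u (b # v) :: _ \<Rightarrow>\<^sub>0 'k)"
      then show ?thesis using IHu[of x "b # v"] by simp
    next
      fix x assume "w = b # x" "x \<in> Poly_Mapping.keys (shuffle_words (a # u) v :: _ \<Rightarrow>\<^sub>0 'k)"
      then show ?thesis using Cons.IH[of x] by simp
    qed
  qed
qed

lemma
  assumes "w \<in> Poly_Mapping.keys (shuffle_words u v :: _ \<Rightarrow>\<^sub>0 'k::field_char_0)"
  shows shuffle_words_set: "set w = set u \<union> set v"
    and shuffle_words_length: "length w = length u + length v"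
    and shuffle_words_wdeg: "wdeg w = wdeg u + wdeg v"
proof -
  note m = shuffle_words_keys [OF assms]
  show "set w = set u \<union> set v" using arg_cong [OF m, of set_mset] by simp
  show "length w = length u + length v" using arg_cong [OF m, of size] by simp
  have "wdeg x = sum_mset (image_mset fst (mset x))" for x :: "'a word"
    by (induction x) simp_all
  then show "wdeg w = wdeg u + wdeg v" by (simp add: m)
qed

lemma shuffle_gen [simp]: "shuffle (gen u) (gen v) = shuffle_words u v"
  by (simp add: shuffle_def)

lemma shuffle_add_left: "shuffle (s + s') t = shuffle s t + shuffle s' t"
  by (simp add: shuffle_def lin_ext_add)

lemma shuffle_diff_left: "shuffle (s - s') t = shuffle s t - shuffle s' t"
  by (simp add: shuffle_def lin_ext_linear)

lemma shuffle_sum_left: "shuffle (\<Sum>i\<in>I. s i) t = (\<Sum>i\<in>I. shuffle (s i) t)"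
  by (simp add: shuffle_def lin_ext_sum)

lemma shuffle_sum_right: "shuffle s (\<Sum>i\<in>I. t i) = (\<Sum>i\<in>I. shuffle s (t i))"
  by (simp add: shuffle_def lin_ext_sum lin_ext_fun_sum)

lemma shuffle_diff_right: "shuffle s (t - t') = shuffle s t - shuffle s t'"
  by (simp add: shuffle_def lin_ext_linear lin_ext_fun_diff)

lemma shuffle_gen_right: "shuffle s (gen v) = lin_ext (\<lambda>u. shuffle_words u v) s"
  by (simp add: shuffle_def)

lemma shuffle_gen_left: "shuffle (gen u) t = lin_ext (shuffle_words u) t"
  by (simp add: shuffle_def)

lemma shuffle_eq_left: "shuffle s t = lin_ext (\<lambda>u. shuffle (gen u) t) s"
  by (simp add: shuffle_def)

lemma shuffle_eq_right: "shuffle s t = lin_ext (\<lambda>v. shuffle s (gen v)) t"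
  unfolding shuffle_def by (subst lin_ext_swap) simp

text \<open>
  Homogeneity of \<open>s\<close> is what makes the Koszul sign of \<open>b\<close> the same for all words of \<open>prepend a s\<close>.
\<close>

lemma shuffle_prepend:
  assumes "\<And>u. u \<in> Poly_Mapping.keys s \<Longrightarrow> wdeg u = d"
  shows "shuffle (prepend a s) (prepend b t) =
     prepend a (shuffle s (prepend b t)) +
     fscale (ksgn (fst b * (fst a + d))) (prepend b (shuffle (prepend a s) t))"
proof -
  have "shuffle (prepend a s) (prepend b t) = lin_ext (\<lambda>u. lin_ext (\<lambda>v. shuffle_words (a # u) (b # v)) t) s"
    by (simp add: shuffle_def prepend_def lin_ext_lin_ext)
  also have "\<dots> = lin_ext (\<lambda>u. lin_ext (\<lambda>v. prepend a (shuffle_words u (b # v)) +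
     fscale (ksgn (fst b * (fst a + d))) (prepend b (shuffle_words (a # u) v))) t) s"
    by (intro lin_ext_cong) (simp add: shuffle_words_Cons assms)
  also have "\<dots> = prepend a (shuffle s (prepend b t)) +
     fscale (ksgn (fst b * (fst a + d))) (prepend b (shuffle (prepend a s) t))"
    by (simp add: lin_ext_fun_add lin_ext_fun_fscale shuffle_def prepend_def lin_ext_lin_ext)
  finally show ?thesis .
qed

lemma shuffle_one [simp]: "shuffle (gen []) t = t" "shuffle s (gen []) = s"
  using lin_ext_cong[of t "shuffle_words []" gen] by (simp_all add: shuffle_gen_left shuffle_gen_right)

section \<open>Calculating modulo the multilinearity relations\<close>

text \<open>
  Words and tensors in which the empty word is admitted, as tails that may be empty.
\<close>

definition words0 :: "(int \<Rightarrow> 'v set) \<Rightarrow> 'v word set" where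
  "words0 V = {w. \<forall>(i, v) \<in> set w. v \<in> V i}"

definition tbar0 :: "(int \<Rightarrow> 'v set) \<Rightarrow> ('v word \<Rightarrow>\<^sub>0 'k::field_char_0) set" where
  "tbar0 V = {t. Poly_Mapping.keys t \<subseteq> words0 V}"

lemma words_iff: "w \<in> words V \<longleftrightarrow> w \<noteq> [] \<and> w \<in> words0 V"
  by (simp add: words_def words0_def)

lemma words0_simps [simp]:
  "[] \<in> words0 V" "(d, x) # w \<in> words0 V \<longleftrightarrow> x \<in> V d \<and> w \<in> words0 V"
  "u @ v \<in> words0 V \<longleftrightarrow> u \<in> words0 V \<and> v \<in> words0 V"
  by (auto simp: words0_def)

lemma words0_take_drop: "w \<in> words0 V \<Longrightarrow> take k w \<in> words0 V" "w \<in> words0 V \<Longrightarrow> drop k w \<in> words0 V"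
  by (auto simp: words0_def dest: in_set_takeD in_set_dropD)

lemma shuffle_words_words0:
  assumes "u \<in> words0 V" "v \<in> words0 V"
  shows "shuffle_words u v \<in> tbar0 V"
  using assms shuffle_words_set unfolding tbar0_def words0_def by fastforce

lemma tbar_tbar0: "t \<in> tbar V \<Longrightarrow> t \<in> tbar0 V"
  by (auto simp: tbar_def tbar0_def words_iff)

lemma tbar_gen [simp]: "gen w \<in> tbar V \<longleftrightarrow> w \<in> words V"
  by (simp add: tbar_def)

lemma tbar0_gen [simp]: "gen w \<in> tbar0 V \<longleftrightarrow> w \<in> words0 V"
  by (simp add: tbar0_def)

lemma lin_ext_tbar:
  "(\<And>a. a \<in> Poly_Mapping.keys t \<Longrightarrow> f a \<in> tbar V) \<Longrightarrow> lin_ext f t \<in> tbar V"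
  using keys_lin_ext[of f t] by (fastforce simp: tbar_def)

lemma lin_ext_tbar0:
  "(\<And>a. a \<in> Poly_Mapping.keys t \<Longrightarrow> f a \<in> tbar0 V) \<Longrightarrow> lin_ext f t \<in> tbar0 V"
  using keys_lin_ext[of f t] by (fastforce simp: tbar0_def)

lemma prepend_tbar: "x \<in> V d \<Longrightarrow> t \<in> tbar0 V \<Longrightarrow> prepend (d, x) t \<in> tbar V"
  unfolding prepend_def by (rule lin_ext_tbar) (auto simp: tbar0_def words_iff)

lemma tbar0_zero [simp]: "0 \<in> tbar0 V"
  by (simp add: tbar0_def)

lemma tbar0_add: "s \<in> tbar0 V \<Longrightarrow> t \<in> tbar0 V \<Longrightarrow> s + t \<in> tbar0 V"
  using Poly_Mapping.keys_add[of s t] by (auto simp: tbar0_def)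

lemma tbar0_fscale: "t \<in> tbar0 V \<Longrightarrow> fscale c t \<in> tbar0 V"
  using keys_fscale[of c t] by (auto simp: tbar0_def)

lemma tbar0_sum: "(\<And>i. i \<in> I \<Longrightarrow> f i \<in> tbar0 V) \<Longrightarrow> (\<Sum>i\<in>I. f i) \<in> tbar0 V"
  by (induction I rule: infinite_finite_induct) (auto intro!: tbar0_add)

lemma tbar_add: "s \<in> tbar V \<Longrightarrow> t \<in> tbar V \<Longrightarrow> s + t \<in> tbar V"
  using Poly_Mapping.keys_add[of s t] by (auto simp: tbar_def)

lemma tbar_zero [simp]: "0 \<in> tbar V"
  by (simp add: tbar_def)

lemma tbar_sum: "(\<And>i. i \<in> I \<Longrightarrow> f i \<in> tbar V) \<Longrightarrow> (\<Sum>i\<in>I. f i) \<in> tbar V"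
  by (induction I rule: infinite_finite_induct) (auto intro!: tbar_add)

lemma shuffle_words_words:
  assumes "u \<in> words V" "v \<in> words V"
  shows "shuffle_words u v \<in> tbar V"
  using assms shuffle_words_words0[of u V v] shuffle_words_length[of _ u v]
  by (fastforce simp: tbar_def tbar0_def words_iff)

lemma tnull_zero [simp]: "0 \<in> tnull sc V"
  unfolding tnull_def by (rule free.span_zero)

lemma tnull_add: "s \<in> tnull sc V \<Longrightarrow> t \<in> tnull sc V \<Longrightarrow> s + t \<in> tnull sc V"
  unfolding tnull_def by (rule free.span_add)

lemma tnull_fscale: "t \<in> tnull sc V \<Longrightarrow> fscale c t \<in> tnull sc V"
  unfolding tnull_def by (rule free.span_scale)

lemma tnull_sum: "(\<And>i. i \<in> I \<Longrightarrow> t i \<in> tnull sc V) \<Longrightarrow> (\<Sum>i\<in>I. t i) \<in> tnull sc V"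
  unfolding tnull_def by (rule free.span_sum)

lemma lin_ext_tnull:
  "(\<And>a. a \<in> Poly_Mapping.keys t \<Longrightarrow> f a \<in> tnull sc V) \<Longrightarrow> lin_ext f t \<in> tnull sc V"
  unfolding tnull_def by (rule lin_ext_in_span)

lemma teq_refl [simp]: "teq sc V t t"
  by (simp add: teq_def)

lemma teq_sym: "teq sc V s t \<Longrightarrow> teq sc V t s"
  unfolding teq_def using tnull_fscale[of "s - t" sc V "-1"] by simp

lemma teq_trans [trans]: "teq sc V s t \<Longrightarrow> teq sc V t u \<Longrightarrow> teq sc V s u"
  unfolding teq_def using tnull_add[of "s - t" sc V "t - u"] by simp

lemma teq_add: "teq sc V s t \<Longrightarrow> teq sc V s' t' \<Longrightarrow> teq sc V (s + s') (t + t')"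
  unfolding teq_def using tnull_add[of "s - t" sc V "s' - t'"] by (simp add: algebra_simps)

lemma teq_fscale: "teq sc V s t \<Longrightarrow> teq sc V (fscale c s) (fscale c t)"
  unfolding teq_def using tnull_fscale[of "s - t" sc V c] by (simp add: free.scale_right_diff_distrib)

lemma teq_sum: "(\<And>i. i \<in> I \<Longrightarrow> teq sc V (s i) (t i)) \<Longrightarrow> teq sc V (\<Sum>i\<in>I. s i) (\<Sum>i\<in>I. t i)"
  unfolding teq_def sum_subtractf [symmetric] by (rule tnull_sum)

lemma teq_lin_ext:
  "(\<And>a. a \<in> Poly_Mapping.keys t \<Longrightarrow> teq sc V (f a) (g a)) \<Longrightarrow> teq sc V (lin_ext f t) (lin_ext g t)"
  unfolding teq_def lin_ext_fun_diff [symmetric] by (rule lin_ext_tnull)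

lemma tnull_teq: "n \<in> tnull sc V \<longleftrightarrow> teq sc V n 0"
  by (simp add: teq_def)

lemma flinear_tnull:
  assumes "flinear f" "n \<in> tnull sc V"
    and "\<And>w k i a b x y. w \<in> words V \<Longrightarrow> k < length w \<Longrightarrow> x \<in> V i \<Longrightarrow> y \<in> V i \<Longrightarrow>
      f (gen (w[k := (i, sc a x + sc b y)])) - fscale a (f (gen (w[k := (i, x)])))
        - fscale b (f (gen (w[k := (i, y)]))) \<in> tnull scW W"
  shows "f n \<in> tnull scW W"
  unfolding tnull_def
proof (rule flinear_span_subset [OF assms(1) _ assms(2) [unfolded tnull_def]], fold tnull_def)
  fix g assume "g \<in> {gen (w[k := (i, sc a x + sc b y)]) - fscale a (gen (w[k := (i, x)])) - fscale b (gen (w[k := (i, y)]))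
      | w k i a b x y. w \<in> words V \<and> k < length w \<and> x \<in> V i \<and> y \<in> V i}"
  then show "f g \<in> tnull scW W"
    using assms(3) by (auto simp: flinear_diff [OF assms(1)] flinear_fscale [OF assms(1)])
qed

lemma prepend_tnull:
  assumes "x \<in> V d" "n \<in> tnull sc V"
  shows "prepend (d, x) n \<in> tnull sc V"
proof (rule flinear_tnull [OF flinear_prepend assms(2)])
  fix w k i a b y z
  assume "w \<in> words V" "k < length w" "y \<in> V i" "z \<in> V i"
  then show "prepend (d, x) (gen (w[k := (i, sc a y + sc b z)])) -
       fscale a (prepend (d, x) (gen (w[k := (i, y)]))) - fscale b (prepend (d, x) (gen (w[k := (i, z)]))) \<in> tnull sc V"
    using tnull_gen [of "(d, x) # w" V "Suc k" y i z sc a b] assms(1) by (simp add: words_iff)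
qed

lemma shuffle_teq:
  assumes "teq sc V s s'" "teq sc V t t'" "s \<in> tbar V" "t' \<in> tbar V"
  shows "teq sc V (shuffle s t) (shuffle s' t')"
proof -
  have "shuffle s (t - t') \<in> tnull sc V"
    unfolding shuffle_eq_left [of s] using assms
    by (intro lin_ext_tnull shuffle_tnull_right) (auto simp: tbar_def teq_def)
  moreover have "shuffle (s - s') t' \<in> tnull sc V"
    unfolding shuffle_eq_right [of _ t'] using assms
    by (intro lin_ext_tnull shuffle_tnull_left) (auto simp: tbar_def teq_def)
  ultimately have "shuffle s (t - t') + shuffle (s - s') t' \<in> tnull sc V" by (rule tnull_add)
  then show ?thesis by (simp add: teq_def shuffle_diff_left shuffle_diff_right)
qed

lemma cogen_add: "vector_space sc \<Longrightarrow> cogen sc (s + t) d = cogen sc s d + cogen sc t d"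
proof -
  assume vs: "vector_space sc"
  then interpret vector_space sc .
  let ?S = "Poly_Mapping.keys s \<union> Poly_Mapping.keys t"
  have "Poly_Mapping.keys (s + t) \<subseteq> ?S" by (rule Poly_Mapping.keys_add)
  then show ?thesis
    by (simp add: cogen_superset [OF vs, of ?S] lookup_add scale_left_distrib sum.distrib)
qed

lemma cogen_fscale: "vector_space sc \<Longrightarrow> cogen sc (fscale c t) d = sc c (cogen sc t d)"
proof -
  assume vs: "vector_space sc"
  then interpret vector_space sc .
  show ?thesis
    using keys_fscale[of c t]
    by (simp add: cogen_superset [OF vs, of "Poly_Mapping.keys t"] scale_sum_right)
qed

lemma cogen_zero [simp]: "cogen sc 0 d = 0"
  by (simp add: cogen_def)

lemma cogen_diff: "vector_space sc \<Longrightarrow> cogen sc (s - t) d = cogen sc s d - cogen sc t d"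
  using cogen_add[of sc "s - t" t d] by simp

lemma cogen_sum: "vector_space sc \<Longrightarrow> cogen sc (\<Sum>i\<in>I. t i) d = (\<Sum>i\<in>I. cogen sc (t i) d)"
  by (induction I rule: infinite_finite_induct) (auto simp: cogen_add)

lemma cogen_lin_ext:
  "vector_space sc \<Longrightarrow> cogen sc (lin_ext f t) d =
     (\<Sum>w\<in>Poly_Mapping.keys t. sc (Poly_Mapping.lookup t w) (cogen sc (f w) d))"
  by (simp add: lin_ext_def cogen_sum cogen_fscale)

lemma cogen_teq: "vector_space sc \<Longrightarrow> teq sc V s t \<Longrightarrow> cogen sc s d = cogen sc t d"
  using cogen_tnull[of sc "s - t" V d] by (simp add: teq_def cogen_diff)

lemma cogen_lin_ext_zero:
  assumes "vector_space sc" "\<And>w. w \<in> Poly_Mapping.keys t \<Longrightarrow> cogen sc (f w) d = 0"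
  shows "cogen sc (lin_ext f t) d = 0"
proof -
  interpret vector_space sc by fact
  show ?thesis using assms by (simp add: cogen_lin_ext)
qed

lemma cogen_shuffle:
  fixes sc :: "'k::field_char_0 \<Rightarrow> 'v::ab_group_add \<Rightarrow> 'v"
  assumes "vector_space sc" "s \<in> tbar V" "t \<in> tbar V"
  shows "cogen sc (shuffle s t) d = 0"
proof -
  interpret vector_space sc by fact
  have "cogen sc (shuffle_words u v) d = 0" if "u \<in> words V" "v \<in> words V" for u v
  proof -
    have "{w \<in> Poly_Mapping.keys (shuffle_words u v :: _ \<Rightarrow>\<^sub>0 'k). length w = 1 \<and> fst (hd w) = d} = {}"
      using that shuffle_words_length[of _ u v] by (cases u; cases v) (fastforce simp: words_iff)+
    then show ?thesis unfolding cogen_def by (simp only: sum.empty)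
  qed
  then show ?thesis
    unfolding shuffle_def using assms by (intro cogen_lin_ext_zero) (auto simp: tbar_def)
qed

lemma prepend_zero:
  assumes "graded_space sc V" "t \<in> tbar0 V"
  shows "prepend (d, 0) t \<in> tnull sc V"
  unfolding prepend_def
proof (rule lin_ext_tnull)
  interpret vector_space sc using assms(1) by (simp add: graded_space_def)
  fix w assume "w \<in> Poly_Mapping.keys t"
  moreover have "0 \<in> V d" using assms(1) subspace_0 by (auto simp: graded_space_def)
  ultimately show "gen ((d, 0) # w) \<in> tnull sc V"
    using tnull_gen[of "(d, 0) # w" V 0 0 d 0 sc 0 0] assms(2) by (auto simp: tbar0_def words_iff)
qed

lemma prepend_combination:
  assumes "graded_space sc V" "x \<in> V d" "y \<in> V d" "t \<in> tbar0 V"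
  shows "teq sc V (prepend (d, sc a x + sc b y) t) (fscale a (prepend (d, x) t) + fscale b (prepend (d, y) t))"
proof -
  interpret vector_space sc using assms(1) by (simp add: graded_space_def)
  have "lin_ext (\<lambda>w. gen ((d, sc a x + sc b y) # w) - fscale a (gen ((d, x) # w)) - fscale b (gen ((d, y) # w))) t
      \<in> tnull sc V"
  proof (rule lin_ext_tnull)
    fix w assume "w \<in> Poly_Mapping.keys t"
    then show "gen ((d, sc a x + sc b y) # w) - fscale a (gen ((d, x) # w)) - fscale b (gen ((d, y) # w)) \<in> tnull sc V"
      using tnull_gen[of "(d, x) # w" V 0 x d y sc a b] assms by (auto simp: tbar0_def words_iff)
  qed
  then show ?thesis
    unfolding lin_ext_fun_diff lin_ext_fun_fscale teq_def prepend_def by (simp only: diff_diff_eq)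
qed

lemma graded_space_sum:
  assumes "graded_space sc V" "\<And>i. i \<in> I \<Longrightarrow> x i \<in> V d"
  shows "(\<Sum>i\<in>I. sc (c i) (x i)) \<in> V d"
proof -
  interpret vector_space sc using assms(1) by (simp add: graded_space_def)
  show ?thesis using assms by (intro subspace_sum subspace_scale) (auto simp: graded_space_def)
qed

lemma prepend_sum:
  assumes "graded_space sc V" "\<And>i. i \<in> I \<Longrightarrow> x i \<in> V d" "t \<in> tbar0 V"
  shows "teq sc V (\<Sum>i\<in>I. fscale (c i) (prepend (d, x i) t)) (prepend (d, \<Sum>i\<in>I. sc (c i) (x i)) t)"
proof -
  have null: "teq sc V 0 (prepend (d, 0) t)"
    using prepend_zero[OF assms(1,3)] by (simp add: tnull_teq teq_sym)
  show ?thesis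
    using assms(2)
  proof (induction I rule: infinite_finite_induct)
    case (insert i I)
    interpret vector_space sc using assms(1) by (simp add: graded_space_def)
    have "teq sc V (prepend (d, sc (c i) (x i) + sc 1 (\<Sum>i\<in>I. sc (c i) (x i))) t)
        (fscale (c i) (prepend (d, x i) t) + fscale 1 (prepend (d, \<Sum>i\<in>I. sc (c i) (x i)) t))"
      using insert.prems by (intro prepend_combination [OF assms(1) _ _ assms(3)] graded_space_sum [OF assms(1)]) auto
    moreover have "teq sc V (fscale (c i) (prepend (d, x i) t) + (\<Sum>i\<in>I. fscale (c i) (prepend (d, x i) t)))
        (fscale (c i) (prepend (d, x i) t) + prepend (d, \<Sum>i\<in>I. sc (c i) (x i)) t)"
      using insert by (intro teq_add teq_refl) auto
    moreover have "fscale (c i) (prepend (d, x i) t) + (\<Sum>i\<in>I. fscale (c i) (prepend (d, x i) t)) =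
        (\<Sum>i\<in>insert i I. fscale (c i) (prepend (d, x i) t))"
      using insert.hyps by simp
    ultimately have "teq sc V (\<Sum>i\<in>insert i I. fscale (c i) (prepend (d, x i) t))
        (prepend (d, sc (c i) (x i) + sc 1 (\<Sum>i\<in>I. sc (c i) (x i))) t)"
      by (simp only: free.scale_one) (rule teq_trans [OF _ teq_sym])
    then show ?case using insert.hyps by simp
  qed (simp_all add: null)
qed

section \<open>Splitting off the first tensor factor\<close>

definition linear_part :: "('v word \<Rightarrow>\<^sub>0 'k::field_char_0) \<Rightarrow> ('v word \<Rightarrow>\<^sub>0 'k)" where
  "linear_part = lin_ext (\<lambda>w. if length w = 1 then gen w else 0)"

text \<open>
  The multiplication of the tensor algebra, cut down to a left factor of length one, inverts
  deconcatenation away from the linear part: each word of length at least two has exactly one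
  splitting whose left part is a single letter.
\<close>

definition head_join :: "('v word \<Rightarrow>\<^sub>0 'k::field_char_0) \<Rightarrow> ('v word \<Rightarrow>\<^sub>0 'k) \<Rightarrow> ('v word \<Rightarrow>\<^sub>0 'k)" where
  "head_join s t = lin_ext (\<lambda>u. if length u = 1 then prepend (hd u) t else 0) s"

definition join :: "('v word \<times> 'v word \<Rightarrow>\<^sub>0 'k::field_char_0) \<Rightarrow> ('v word \<Rightarrow>\<^sub>0 'k)" where
  "join = lin_ext (\<lambda>(u, v). if length u = 1 then gen (hd u # v) else 0)"

lemma flinear_join: "flinear join" unfolding join_def by (rule flinear_lin_ext)

lemma flinear_linear_part: "flinear linear_part" unfolding linear_part_def by (rule flinear_lin_ext)

lemma flinear_head_join: "flinear (\<lambda>s. head_join s t)" unfolding head_join_def by (rule flinear_lin_ext)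

lemma join_otimes: "join (otimes s t) = head_join s t"
  unfolding join_def head_join_def lin_ext_otimes by (intro lin_ext_cong) (auto simp: prepend_def)

lemma head_join_gen [simp]: "head_join (gen u) t = (if length u = 1 then prepend (hd u) t else 0)"
  by (simp add: head_join_def)

lemma head_join_linear_part: "head_join (linear_part s) t = head_join s t"
  unfolding head_join_def linear_part_def lin_ext_lin_ext by (intro lin_ext_cong) auto

lemma head_join_tnull_right:
  assumes "s \<in> tbar V" "n \<in> tnull sc V"
  shows "head_join s n \<in> tnull sc V"
  unfolding head_join_def
proof (rule lin_ext_tnull)
  fix u assume "u \<in> Poly_Mapping.keys s"
  then have "u \<in> words V" using assms(1) by (auto simp: tbar_def)
  then show "(if length u = 1 then prepend (hd u) n else 0) \<in> tnull sc V"
    using prepend_tnull[OF _ assms(2)] by (cases u) (auto simp: words_iff)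
qed

lemma head_join_tnull_left:
  assumes "graded_space sc V" "n \<in> tnull sc V" "t \<in> tbar0 V"
  shows "head_join n t \<in> tnull sc V"
proof (rule flinear_tnull [OF flinear_head_join assms(2)])
  fix w k i a b x y
  assume "w \<in> words V" "k < length w" "x \<in> V i" "y \<in> V i"
  then show "head_join (gen (w[k := (i, sc a x + sc b y)])) t - fscale a (head_join (gen (w[k := (i, x)])) t) -
       fscale b (head_join (gen (w[k := (i, y)])) t) \<in> tnull sc V"
    using prepend_combination [OF assms(1) _ _ assms(3), of x i y a b]
    by (cases "length w = 1") (auto simp: teq_def diff_diff_eq length_Suc_conv)
qed

text \<open>
  The equations for coderivations and coalgebra morphisms hold only modulo \<open>tnull2\<close>; \<open>join\<close> brings
  them back to equations between tensors.
\<close>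

lemma join_tnull2:
  assumes "graded_space sc V" "z \<in> tnull2 sc V"
  shows "join z \<in> tnull sc V"
  unfolding tnull_def
proof (rule flinear_span_subset [OF flinear_join _ assms(2) [unfolded tnull2_def]], fold tnull_def)
  fix g :: "'b word \<times> 'b word \<Rightarrow>\<^sub>0 'a"
  assume "g \<in> {otimes n t | n t. n \<in> tnull sc V \<and> t \<in> tbar V} \<union> {otimes t n | n t. n \<in> tnull sc V \<and> t \<in> tbar V}"
  then show "join g \<in> tnull sc V"
    by (auto simp: join_otimes intro: head_join_tnull_left [OF assms(1) _ tbar_tbar0] head_join_tnull_right)
qed

lemma join_coproduct:
  assumes "t \<in> tbar V" shows "join (coproduct t) = t - linear_part t"
proof -
  have "join (coproduct t) = lin_ext (\<lambda>w. gen w - (if length w = 1 then gen w else 0)) t"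
    unfolding join_def coproduct_def lin_ext_lin_ext
  proof (rule lin_ext_cong, unfold lin_ext_sum)
    fix w assume "w \<in> Poly_Mapping.keys t"
    then have ne: "w \<noteq> []" using assms by (auto simp: tbar_def words_iff)
    have "1 < length w \<or> length w = 1" using ne by (cases w) auto
    have "(\<Sum>k\<in>{1..<length w}. lin_ext (\<lambda>(u, v). if length u = 1 then gen (hd u # v) else 0) (gen (take k w, drop k w)))
       = (\<Sum>k\<in>{1..<length w}. if k = 1 then gen w else (0 :: _ \<Rightarrow>\<^sub>0 'b))"
      using ne by (intro sum.cong) (cases w; auto)+
    then show "(\<Sum>k\<in>{1..<length w}. lin_ext (\<lambda>(u, v). if length u = 1 then gen (hd u # v) else 0) (gen (take k w, drop k w)))
       = gen w - (if length w = 1 then gen w else (0 :: _ \<Rightarrow>\<^sub>0 'b))"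
      using \<open>1 < length w \<or> length w = 1\<close> by (elim disjE) simp_all
  qed
  then show ?thesis by (simp add: lin_ext_fun_diff linear_part_def)
qed

text \<open>
  Being homogeneous, an image of a word has a linear part in one degree only, so by linearity this
  part is a single letter, whose vector is the value of the Taylor coefficient.
\<close>

lemma linear_part_teq:
  assumes "graded_space sc V" "teq sc V s t" "t \<in> tbar_deg V d"
  shows "teq sc V (linear_part s) (gen [(d, cogen sc s d)])"
proof -
  have vs: "vector_space sc" using assms(1) by (simp add: graded_space_def)
  have "linear_part (s - t) \<in> tnull sc V"
  proof (rule flinear_tnull [OF flinear_linear_part assms(2)[unfolded teq_def]])
    fix w k i a b x y
    assume "w \<in> words V" "k < length w" "x \<in> V i" "y \<in> V i"
    then show "linear_part (gen (w[k := (i, sc a x + sc b y)])) - fscale a (linear_part (gen (w[k := (i, x)]))) -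
       fscale b (linear_part (gen (w[k := (i, y)]))) \<in> tnull sc V"
      using tnull_gen[of w V k x i y sc a b] by (simp add: linear_part_def)
  qed
  then have "teq sc V (linear_part s) (linear_part t)"
    by (simp add: teq_def flinear_diff [OF flinear_linear_part])
  also have "teq sc V (linear_part t) (gen [(d, cogen sc t d)])"
  proof -
    let ?S = "{w \<in> Poly_Mapping.keys t. length w = 1 \<and> fst (hd w) = d}"
    have t: "\<And>w. w \<in> Poly_Mapping.keys t \<Longrightarrow> w \<in> words V \<and> wdeg w = d"
      using assms(3) by (auto simp: tbar_deg_def tbar_def)
    have S: "w = [(d, snd (hd w))] \<and> snd (hd w) \<in> V d" if "w \<in> ?S" for w
      using that t[of w] by (cases w) (auto simp: words_iff)
    have "linear_part t = (\<Sum>w\<in>?S. fscale (Poly_Mapping.lookup t w) (prepend (d, snd (hd w)) (gen [])))"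
      unfolding linear_part_def lin_ext_def
    proof (rule sum.mono_neutral_cong_right)
      fix w assume "w \<in> ?S"
      moreover from S[OF this] have "[(d, snd (hd w))] = w" by simp
      ultimately show "fscale (Poly_Mapping.lookup t w) (if length w = 1 then gen w else 0) =
         fscale (Poly_Mapping.lookup t w) (prepend (d, snd (hd w)) (gen []))"
        by (simp only: prepend_gen) simp
    next
      show "\<forall>w\<in>Poly_Mapping.keys t - ?S. fscale (Poly_Mapping.lookup t w) (if length w = 1 then gen w else 0) = 0"
      proof
        fix w assume w: "w \<in> Poly_Mapping.keys t - ?S"
        then have "length w \<noteq> 1" using t[of w] by (cases w) auto
        then show "fscale (Poly_Mapping.lookup t w) (if length w = 1 then gen w else 0) = 0" by simp
      qed
    qed auto
    also have "teq sc V \<dots> (prepend (d, \<Sum>w\<in>?S. sc (Poly_Mapping.lookup t w) (snd (hd w))) (gen []))"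
      using S by (intro prepend_sum [OF assms(1)]) auto
    finally show ?thesis by (simp add: cogen_def)
  qed
  finally show ?thesis by (simp add: cogen_teq [OF vs assms(2)])
qed

lemma head_join_teq:
  assumes "graded_space sc V" "teq sc V s s'" "s' \<in> tbar_deg V d" "t \<in> tbar0 V"
  shows "teq sc V (head_join s t) (prepend (d, cogen sc s d) t)"
proof -
  have "linear_part s - gen [(d, cogen sc s d)] \<in> tnull sc V"
    using linear_part_teq [OF assms(1-3)] by (simp add: teq_def)
  from head_join_tnull_left [OF assms(1) this assms(4)]
  show ?thesis by (simp add: teq_def flinear_diff [OF flinear_head_join] head_join_linear_part)
qed

lemma cogen_in_space:
  assumes "graded_space sc V" "t \<in> tbar V"
  shows "cogen sc t d \<in> V d"
  unfolding cogen_def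
proof (rule graded_space_sum [OF assms(1)])
  fix w assume "w \<in> {w \<in> Poly_Mapping.keys t. length w = 1 \<and> fst (hd w) = d}"
  then show "snd (hd w) \<in> V d" using assms(2) by (cases w) (auto simp: tbar_def words_iff)
qed

lemma
  assumes "tensor_map scV V scW W e f"
  shows tensor_map_flinear: "flinear f"
    and tensor_map_tbar: "t \<in> tbar V \<Longrightarrow> f t \<in> tbar W"
    and tensor_map_teq: "teq scV V s t \<Longrightarrow> teq scW W (f s) (f t)"
    and tensor_map_homogeneous: "w \<in> words V \<Longrightarrow> \<exists>t \<in> tbar_deg W (wdeg w + e). teq scW W (f (gen w)) t"
  using assms flinear_diff[of f s t] unfolding tensor_map_def teq_def by auto

lemma tensor_map_head_join:
  assumes "graded_space scW W" "tensor_map scV V scW W e f" "w \<in> words V" "t \<in> tbar0 W"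
  shows "teq scW W (head_join (f (gen w)) t)
     (prepend (wdeg w + e, taylor scW f w (wdeg w + e)) t)"
  using tensor_map_homogeneous [OF assms(2,3)] head_join_teq [OF assms(1) _ _ assms(4)]
  by (auto simp: taylor_def)

lemma tensor_map_linear_part:
  assumes "graded_space scW W" "tensor_map scV V scW W e f" "w \<in> words V"
  shows "teq scW W (linear_part (f (gen w))) (gen [(wdeg w + e, taylor scW f w (wdeg w + e))])"
  using tensor_map_homogeneous [OF assms(2,3)] linear_part_teq [OF assms(1)]
  by (auto simp: taylor_def)

text \<open>
  The common source of the recursions for coderivations and for coalgebra morphisms: \<open>join\<close>
  recovers everything but the linear part from the coproduct, and the Taylor coefficient is the
  linear part.
\<close>

lemma tensor_map_teq2:
  assumes "graded_space scW W" "tensor_map scV V scW W e f" "w \<in> words V"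
    and "teq2 scW W (coproduct (f (gen w))) z"
  shows "teq scW W (f (gen w)) (gen [(wdeg w + e, taylor scW f w (wdeg w + e))] + join z)"
proof -
  let ?p = "linear_part (f (gen w))"
  have "f (gen w) \<in> tbar W" using tensor_map_tbar [OF assms(2)] assms(3) by simp
  then have "join (coproduct (f (gen w)) - z) = f (gen w) - ?p - join z"
    by (simp add: flinear_diff [OF flinear_join] join_coproduct)
  then have "teq scW W (f (gen w)) (?p + join z)"
    using join_tnull2 [OF assms(1) assms(4)[unfolded teq2_def]] by (simp add: teq_def diff_diff_eq)
  also have "teq scW W (?p + join z) (gen [(wdeg w + e, taylor scW f w (wdeg w + e))] + join z)"
    by (intro teq_add teq_refl tensor_map_linear_part [OF assms(1-3)])
  finally show ?thesis .
qed

lemma map_otimes_coproduct: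
  "map_otimes f e g (coproduct (gen w)) =
     (\<Sum>k\<in>{1..<length w}. fscale (ksgn (e * wdeg (take k w))) (otimes (f (gen (take k w))) (g (gen (drop k w)))))"
  by (simp add: map_otimes_def coproduct_def lin_ext_sum)

lemma join_map_otimes_coproduct:
  "join (map_otimes f e g (coproduct (gen w))) =
     (\<Sum>k\<in>{1..<length w}. fscale (ksgn (e * wdeg (take k w))) (head_join (f (gen (take k w))) (g (gen (drop k w)))))"
  by (simp add: map_otimes_coproduct flinear_sum [OF flinear_join] flinear_fscale [OF flinear_join] join_otimes)

section \<open>Coalgebra morphisms and shuffles\<close>

text \<open>
  The coalgebra morphism into the cofree coalgebra with prescribed Taylor coefficients \<open>\<phi>\<close>.  Unfolded,
  the recursion runs over all ways to cut \<open>w\<close> into nonempty pieces and applies \<open>\<phi>\<close> to each piece; the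
  form below exposes the first piece, in step with the first-letter recursion of the shuffle
  product.  All its words have exactly the degree of \<open>w\<close>, as the signs in \<open>shuffle_prepend\<close> require.
\<close>

function coext :: "('v word \<Rightarrow> 'w) \<Rightarrow> 'v word \<Rightarrow> ('w word \<Rightarrow>\<^sub>0 'k::field_char_0)" where
  "coext \<phi> w = (if w = [] then gen []
     else \<Sum>k\<in>{1..length w}. prepend (wdeg (take k w), \<phi> (take k w)) (coext \<phi> (drop k w)))"
  by pat_completeness auto
termination by (relation "measure (\<lambda>(\<phi>, w). length w)") auto

declare coext.simps [simp del]

lemma coext_Nil [simp]: "coext \<phi> [] = gen []"
  by (simp add: coext.simps)

lemma coext_eq:
  "w \<noteq> [] \<Longrightarrow> coext \<phi> w = (\<Sum>k\<in>{1..length w}. prepend (wdeg (take k w), \<phi> (take k w)) (coext \<phi> (drop k w)))"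
  by (subst coext.simps) simp

lemma coext_tbar0:
  assumes "\<And>u. u \<in> words V \<Longrightarrow> \<phi> u \<in> W (wdeg u)" "w \<in> words0 V"
  shows "(coext \<phi> w :: _ \<Rightarrow>\<^sub>0 'k::field_char_0) \<in> tbar0 W"
  using assms(2)
proof (induction w rule: length_induct)
  case (1 w)
  show ?case
  proof (cases "w = []")
    case False
    show ?thesis unfolding coext_eq [OF False]
    proof (rule tbar0_sum, rule tbar_tbar0, rule prepend_tbar)
      fix k assume k: "k \<in> {1..length w}"
      show "\<phi> (take k w) \<in> W (wdeg (take k w))"
        using k False "1.prems" by (intro assms(1)) (auto simp: words_iff words0_take_drop)
      show "(coext \<phi> (drop k w) :: _ \<Rightarrow>\<^sub>0 'k) \<in> tbar0 W"
        using k False "1.prems" "1.IH"[rule_format, of "drop k w"] by (simp add: words0_take_drop)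
    qed
  qed simp
qed

lemma coext_tbar:
  assumes "\<And>u. u \<in> words V \<Longrightarrow> \<phi> u \<in> W (wdeg u)" "w \<in> words V"
  shows "coext \<phi> w \<in> tbar W"
proof -
  have w: "w \<noteq> []" "w \<in> words0 V" using assms(2) by (auto simp: words_iff)
  show ?thesis unfolding coext_eq [OF w(1)]
    using w by (intro tbar_sum prepend_tbar assms(1) coext_tbar0 [where V = V])
      (auto simp: words_iff words0_take_drop)
qed

lemma coext_wdeg: "x \<in> Poly_Mapping.keys (coext \<phi> w :: _ \<Rightarrow>\<^sub>0 'k::field_char_0) \<Longrightarrow> wdeg x = wdeg w"
proof (induction w arbitrary: x rule: length_induct)
  case (1 w)
  show ?case
  proof (cases "w = []")
    case True then show ?thesis using "1.prems" by simp
  next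
    case False
    obtain k where k: "k \<in> {1..length w}"
      and "x \<in> Poly_Mapping.keys (prepend (wdeg (take k w), \<phi> (take k w)) (coext \<phi> (drop k w)) :: _ \<Rightarrow>\<^sub>0 'k)"
      using "1.prems" keys_sum unfolding coext_eq [OF False] by fast
    then obtain y where y: "y \<in> Poly_Mapping.keys (coext \<phi> (drop k w) :: _ \<Rightarrow>\<^sub>0 'k)"
      and x: "x = (wdeg (take k w), \<phi> (take k w)) # y"
      using keys_lin_ext[of "\<lambda>x. gen ((wdeg (take k w), \<phi> (take k w)) # x)" "coext \<phi> (drop k w) :: _ \<Rightarrow>\<^sub>0 'k"]
      unfolding prepend_def by auto
    have "wdeg y = wdeg (drop k w)" using "1.IH" k y False by simp
    then show ?thesis using x wdeg_simps(3)[of "take k w" "drop k w"] by simp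
  qed
qed

text \<open>
  Joining the equation for the coproduct of \<open>F w\<close> gives the recursion that defines \<open>coext\<close>.
\<close>

lemma coalgebra_morphism_coext:
  assumes "graded_space scW W" "coalgebra_morphism scV V scW W F" "w \<in> words V"
  shows "teq scW W (F (gen w)) (coext (\<lambda>u. taylor scW F u (wdeg u)) w)"
  using assms(3)
proof (induction w rule: length_induct)
  case (1 w)
  let ?\<phi> = "\<lambda>u. taylor scW F u (wdeg u)"
  let ?l = "\<lambda>k. (wdeg (take k w), ?\<phi> (take k w))"
  have F: "tensor_map scV V scW W 0 F" using assms(2) by (simp add: coalgebra_morphism_def)
  have w: "w \<noteq> []" "w \<in> words V" using "1.prems" by (auto simp: words_iff)
  have "teq2 scW W (coproduct (F (gen w))) (map_otimes F 0 F (coproduct (gen w)))"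
    using assms(2) w by (simp add: coalgebra_morphism_def)
  from tensor_map_teq2 [OF assms(1) F w(2) this]
  have "teq scW W (F (gen w)) (gen [(wdeg w, ?\<phi> w)] +
      (\<Sum>k\<in>{1..<length w}. head_join (F (gen (take k w))) (F (gen (drop k w)))))"
    by (simp add: join_map_otimes_coproduct)
  also have "teq scW W \<dots> (gen [(wdeg w, ?\<phi> w)] +
      (\<Sum>k\<in>{1..<length w}. prepend (?l k) (coext ?\<phi> (drop k w))))"
  proof (intro teq_add teq_refl teq_sum)
    fix k assume k: "k \<in> {1..<length w}"
    have tk: "take k w \<in> words V" and dr: "drop k w \<in> words V"
      using w k by (auto simp: words_iff words0_take_drop)
    have "F (gen (drop k w)) \<in> tbar0 W" using tensor_map_tbar [OF F] dr tbar_tbar0 by (metis tbar_gen)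
    from tensor_map_head_join [OF assms(1) F tk this]
    have "teq scW W (head_join (F (gen (take k w))) (F (gen (drop k w)))) (prepend (?l k) (F (gen (drop k w))))"
      by simp
    also have "teq scW W \<dots> (prepend (?l k) (coext ?\<phi> (drop k w)))"
    proof -
      have "F (gen (drop k w)) - coext ?\<phi> (drop k w) \<in> tnull scW W"
        using "1.IH" dr k w by (simp add: teq_def)
      moreover have "?\<phi> (take k w) \<in> W (wdeg (take k w))"
        unfolding taylor_def using tensor_map_tbar [OF F] tk by (intro cogen_in_space [OF assms(1)]) simp
      ultimately show ?thesis
        unfolding teq_def flinear_diff [OF flinear_prepend, symmetric] by (intro prepend_tnull)
    qed
    finally show "teq scW W (head_join (F (gen (take k w))) (F (gen (drop k w))))
        (prepend (?l k) (coext ?\<phi> (drop k w)))" .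
  qed
  also have "gen [(wdeg w, ?\<phi> w)] + (\<Sum>k\<in>{1..<length w}. prepend (?l k) (coext ?\<phi> (drop k w))) = coext ?\<phi> w"
  proof -
    have "{1..length w} = insert (length w) {1..<length w}" using w by (cases w) auto
    then show ?thesis unfolding coext_eq [OF w(1)] by simp
  qed
  finally show ?case .
qed

lemma sum_atMost_split: "(\<Sum>k\<le>n. f k) = f 0 + (\<Sum>k\<in>{1..n::nat}. f k)"
proof -
  have "{..n} = insert 0 {1..n}" by auto
  then show ?thesis by simp
qed

text \<open>
  The first piece cut off from a shuffled word is itself a shuffle of an initial part of \<open>u\<close> and an
  initial part of \<open>v\<close>, by \<open>splits_shuffle_words\<close>.
\<close>

lemma coext_shuffle_words:
  fixes \<phi> :: "'v word \<Rightarrow> 'w"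
  assumes "u \<noteq> [] \<or> v \<noteq> []"
  shows "(lin_ext (coext \<phi>) (shuffle_words u v) :: _ \<Rightarrow>\<^sub>0 'k::field_char_0) =
    (\<Sum>k\<le>length u. \<Sum>l\<le>length v. fscale (ksgn (wdeg (drop k u) * wdeg (take l v)))
      (lin_ext (\<lambda>x. if x = [] then 0 else
           prepend (wdeg x, \<phi> x) (lin_ext (coext \<phi>) (shuffle_words (drop k u) (drop l v))))
         (shuffle_words (take k u) (take l v))))"
proof -
  define J :: "_ \<Rightarrow> 'w word \<Rightarrow>\<^sub>0 'k"
    where "J = lin_ext (\<lambda>(x, y). if x = [] then 0 else prepend (wdeg x, \<phi> x) (coext \<phi> y))"
  have J: "flinear J" unfolding J_def by (rule flinear_lin_ext)
  have coext_J: "coext \<phi> w = J (splits w)" if "w \<noteq> []" for w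
  proof -
    have "J (splits w) = (\<Sum>k\<le>length w. if take k w = [] then 0 else prepend (wdeg (take k w), \<phi> (take k w)) (coext \<phi> (drop k w)))"
      unfolding splits_def flinear_sum [OF J] by (simp add: J_def)
    also have "\<dots> = coext \<phi> w"
      unfolding sum_atMost_split coext_eq [OF that] using that by (auto intro!: sum.cong)
    finally show ?thesis ..
  qed
  have J_otimes: "J (otimes s t) =
      lin_ext (\<lambda>x. if x = [] then 0 else prepend (wdeg x, \<phi> x) (lin_ext (coext \<phi>) t)) s" for s t
    unfolding J_def lin_ext_otimes
    by (intro lin_ext_cong) (simp add: flinear_comp_lin_ext [OF flinear_prepend])
  have "lin_ext (coext \<phi>) (shuffle_words u v) = lin_ext (\<lambda>w. J (splits w)) (shuffle_words u v)"
  proof (rule lin_ext_cong, rule coext_J)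
    fix w assume "w \<in> Poly_Mapping.keys (shuffle_words u v :: _ \<Rightarrow>\<^sub>0 'k)"
    then show "w \<noteq> []" using shuffle_words_length assms by fastforce
  qed
  also have "\<dots> = J (lin_ext splits (shuffle_words u v))"
    by (simp add: flinear_comp_lin_ext [OF J])
  finally show ?thesis
    unfolding splits_shuffle_words flinear_sum [OF J] flinear_fscale [OF J] J_otimes .
qed

text \<open>
  Sum \<open>shuffle_prepend\<close> over all pairs of first pieces.  For a fixed first piece of \<open>u\<close> the
  terms recombine to all of \<open>coext \<phi> v\<close>, and symmetrically; the sign is that of moving a piece of
  \<open>v\<close> past the whole of \<open>u\<close>.
\<close>

lemma shuffle_coext:
  assumes "u \<noteq> []" "v \<noteq> []"
  shows "shuffle (coext \<phi> u) (coext \<phi> v) =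
     (\<Sum>k\<in>{1..length u}. prepend (wdeg (take k u), \<phi> (take k u)) (shuffle (coext \<phi> (drop k u)) (coext \<phi> v))) +
     (\<Sum>l\<in>{1..length v}. fscale (ksgn (wdeg u * wdeg (take l v)))
        (prepend (wdeg (take l v), \<phi> (take l v)) (shuffle (coext \<phi> u) (coext \<phi> (drop l v)))))"
proof -
  let ?a = "\<lambda>k. (wdeg (take k u), \<phi> (take k u))" and ?b = "\<lambda>l. (wdeg (take l v), \<phi> (take l v))"
  let ?U = "\<lambda>k. coext \<phi> (drop k u)" and ?V = "\<lambda>l. coext \<phi> (drop l v)"
  have "shuffle (coext \<phi> u) (coext \<phi> v) =
      (\<Sum>k\<in>{1..length u}. \<Sum>l\<in>{1..length v}. shuffle (prepend (?a k) (?U k)) (prepend (?b l) (?V l)))"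
    unfolding coext_eq [OF assms(1)] coext_eq [OF assms(2)] shuffle_sum_left shuffle_sum_right
    by (rule sum.swap)
  also have "\<dots> = (\<Sum>k\<in>{1..length u}. \<Sum>l\<in>{1..length v}. prepend (?a k) (shuffle (?U k) (prepend (?b l) (?V l))) +
        fscale (ksgn (wdeg u * wdeg (take l v))) (prepend (?b l) (shuffle (prepend (?a k) (?U k)) (?V l))))"
  proof (intro sum.cong refl)
    fix k l
    have "wdeg (take k u) + wdeg (drop k u) = wdeg u"
      using wdeg_simps(3)[of "take k u" "drop k u"] by simp
    then show "shuffle (prepend (?a k) (?U k)) (prepend (?b l) (?V l)) =
        prepend (?a k) (shuffle (?U k) (prepend (?b l) (?V l))) +
        fscale (ksgn (wdeg u * wdeg (take l v))) (prepend (?b l) (shuffle (prepend (?a k) (?U k)) (?V l)))"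
      by (subst shuffle_prepend [where d = "wdeg (drop k u)"]) (simp_all add: coext_wdeg mult.commute)
  qed
  also have "\<dots> = (\<Sum>k\<in>{1..length u}. prepend (?a k) (shuffle (?U k) (coext \<phi> v))) +
        (\<Sum>l\<in>{1..length v}. fscale (ksgn (wdeg u * wdeg (take l v))) (prepend (?b l) (shuffle (coext \<phi> u) (?V l))))"
    unfolding sum.distrib coext_eq [OF assms(1)] coext_eq [OF assms(2)] shuffle_sum_left shuffle_sum_right
      flinear_sum [OF flinear_prepend] free.scale_sum_right
    by (intro arg_cong2 [where f = "(+)"] refl sum.swap)
  finally show ?thesis .
qed

text \<open>
  In the expansion of \<open>coext_shuffle_words\<close> the terms whose first piece mixes letters of \<open>u\<close> and \<open>v\<close>
  vanish, since \<open>\<phi>\<close> is applied to a shuffle there.  What is left matches the expansion of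
  \<open>shuffle_coext\<close>, by induction.  The vanishing is assumed only for shuffles with fewer letters and
  for the pair itself, because at the point of use the other pairs of the same total length are
  not settled yet.
\<close>

lemma coext_multiplicative:
  assumes "graded_space scW W" "\<And>w. w \<in> words V \<Longrightarrow> \<phi> w \<in> W (wdeg w)"
    and "\<And>u' v'. u' \<in> words V \<Longrightarrow> v' \<in> words V \<Longrightarrow>
      length u' + length v' < length u + length v \<or> (u' = u \<and> v' = v) \<Longrightarrow>
      (\<Sum>x\<in>Poly_Mapping.keys (shuffle_words u' v' :: _ \<Rightarrow>\<^sub>0 'k).
         scW (Poly_Mapping.lookup (shuffle_words u' v') x) (\<phi> x)) = 0"
    and "u \<in> words0 V" "v \<in> words0 V"
  shows "teq (scW :: 'k::field_char_0 \<Rightarrow> 'w::ab_group_add \<Rightarrow> 'w) W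
     (lin_ext (coext \<phi>) (shuffle_words u v)) (shuffle (coext \<phi> u) (coext \<phi> v))"
  using assms(3-5)
proof (induction "length u + length v" arbitrary: u v rule: less_induct)
  case less
  show ?case
  proof (cases "u = [] \<or> v = []")
    case True
    then show ?thesis by auto
  next
    case False
    define G where "G = (lin_ext (coext \<phi>) :: _ \<Rightarrow> 'w word \<Rightarrow>\<^sub>0 'k)"
    define T where "T k l = G (shuffle_words (drop k u) (drop l v))" for k l
    define S where "S k l = fscale (ksgn (wdeg (drop k u) * wdeg (take l v)))
        (lin_ext (\<lambda>x. if x = [] then 0 else prepend (wdeg x, \<phi> x) (T k l)) (shuffle_words (take k u) (take l v)))" for k l
    have words: "take k u \<in> words V" if "k \<in> {1..length u}" for k
      using that less.prems False by (auto simp: words_iff words0_take_drop)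
    have words': "take l v \<in> words V" if "l \<in> {1..length v}" for l
      using that less.prems False by (auto simp: words_iff words0_take_drop)
    have T: "T k l \<in> tbar0 W" for k l
      unfolding T_def G_def
    proof (intro lin_ext_tbar0 coext_tbar0 [where V = V and W = W and \<phi> = \<phi>, OF assms(2)])
      fix x assume "x \<in> Poly_Mapping.keys (shuffle_words (drop k u) (drop l v) :: _ \<Rightarrow>\<^sub>0 'k)"
      moreover have "(shuffle_words (drop k u) (drop l v) :: _ \<Rightarrow>\<^sub>0 'k) \<in> tbar0 V"
        using less.prems by (intro shuffle_words_words0 words0_take_drop)
      ultimately show "x \<in> words0 V" by (auto simp: tbar0_def)
    qed
    \<comment> \<open>The mixed terms: all words of the left shuffle have the same degree, so they combine into a
      single letter, whose vector is the value of \<open>\<phi>\<close> on the shuffle.\<close>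
    have S: "teq scW W (S k l) 0" if k: "k \<in> {1..length u}" and l: "l \<in> {1..length v}" for k l
    proof -
      let ?s = "shuffle_words (take k u) (take l v) :: _ \<Rightarrow>\<^sub>0 'k"
      let ?d = "wdeg (take k u) + wdeg (take l v)"
      have x: "x \<in> words V \<and> wdeg x = ?d" if "x \<in> Poly_Mapping.keys ?s" for x
      proof -
        have "?s \<in> tbar V" by (rule shuffle_words_words[OF words[OF k] words'[OF l]])
        then show ?thesis using that shuffle_words_wdeg[OF that] by (auto simp: tbar_def)
      qed
      have small: "length (take k u) + length (take l v) < length u + length v \<or> (take k u = u \<and> take l v = v)"
        using k l by auto
      have "lin_ext (\<lambda>x. if x = [] then 0 else prepend (wdeg x, \<phi> x) (T k l)) ?s =
          (\<Sum>x\<in>Poly_Mapping.keys ?s. fscale (Poly_Mapping.lookup ?s x) (prepend (?d, \<phi> x) (T k l)))"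
        unfolding lin_ext_def using x by (intro sum.cong) (auto simp: words_iff)
      also have "teq scW W \<dots> (prepend (?d, \<Sum>x\<in>Poly_Mapping.keys ?s. scW (Poly_Mapping.lookup ?s x) (\<phi> x)) (T k l))"
        using x assms(2) by (intro prepend_sum [OF assms(1) _ T]) metis
      also have "(\<Sum>x\<in>Poly_Mapping.keys ?s. scW (Poly_Mapping.lookup ?s x) (\<phi> x)) = 0"
        by (rule less.prems(1) [OF words[OF k] words'[OF l] small])
      also have "teq scW W (prepend (?d, 0) (T k l)) 0"
        using prepend_zero [OF assms(1) T] by (simp add: tnull_teq)
      finally show ?thesis unfolding S_def using teq_fscale by fastforce
    qed
    have IH: "teq scW W (T k l) (shuffle (coext \<phi> (drop k u)) (coext \<phi> (drop l v)))"
      if "k \<le> length u" "l \<le> length v" "k + l > 0" for k l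
      unfolding T_def G_def
    proof (rule less.hyps)
      show "length (drop k u) + length (drop l v) < length u + length v" using that by auto
    next
      fix u' v' assume "u' \<in> words V" "v' \<in> words V"
        "length u' + length v' < length (drop k u) + length (drop l v) \<or> u' = drop k u \<and> v' = drop l v"
      then show "(\<Sum>x\<in>Poly_Mapping.keys (shuffle_words u' v' :: _ \<Rightarrow>\<^sub>0 'k).
         scW (Poly_Mapping.lookup (shuffle_words u' v') x) (\<phi> x)) = 0"
        using that by (intro less.prems(1)) auto
    qed (use less.prems in \<open>simp_all add: words0_take_drop\<close>)
    have cong: "teq scW W (prepend (d, x) s) (prepend (d, x) t)" if "x \<in> W d" "teq scW W s t" for d x s t
      using that prepend_tnull unfolding teq_def flinear_diff [OF flinear_prepend, symmetric] by blast
    define L :: "nat \<Rightarrow> 'w word \<Rightarrow>\<^sub>0 'k" where "L l = fscale (ksgn (wdeg u * wdeg (take l v)))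
        (prepend (wdeg (take l v), \<phi> (take l v)) (shuffle (coext \<phi> u) (coext \<phi> (drop l v))))" for l
    define K :: "nat \<Rightarrow> 'w word \<Rightarrow>\<^sub>0 'k" where "K k = prepend (wdeg (take k u), \<phi> (take k u)) (shuffle (coext \<phi> (drop k u)) (coext \<phi> v))" for k
    have S0: "S 0 0 = 0" by (simp add: S_def)
    have SL: "teq scW W (S 0 l) (L l)" if l: "l \<in> {1..length v}" for l
    proof -
      have "S 0 l = fscale (ksgn (wdeg u * wdeg (take l v))) (prepend (wdeg (take l v), \<phi> (take l v)) (T 0 l))"
        using l by (auto simp: S_def)
      then show ?thesis
        unfolding L_def using IH[of 0 l] l words'[OF l] by (auto intro!: teq_fscale cong assms(2))
    qed
    have SK: "teq scW W (S k 0) (K k)" if k: "k \<in> {1..length u}" for k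
    proof -
      have "S k 0 = prepend (wdeg (take k u), \<phi> (take k u)) (T k 0)"
        using k by (auto simp: S_def)
      then show ?thesis
        unfolding K_def using IH[of k 0] k words[OF k] by (auto intro!: cong assms(2))
    qed
    have "G (shuffle_words u v) = (\<Sum>k\<le>length u. \<Sum>l\<le>length v. S k l)"
      unfolding G_def S_def T_def using False by (intro coext_shuffle_words) simp
    also have "\<dots> = (\<Sum>l\<in>{1..length v}. S 0 l) +
        (\<Sum>k\<in>{1..length u}. S k 0 + (\<Sum>l\<in>{1..length v}. S k l))"
      by (simp only: sum_atMost_split S0 add_0_left)
    finally have "teq scW W (G (shuffle_words u v))
        ((\<Sum>l\<in>{1..length v}. L l) + (\<Sum>k\<in>{1..length u}. K k + (\<Sum>l\<in>{1..length v}. 0)))"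
      by (simp only:) (intro teq_add teq_sum SL SK S)
    moreover have "(\<Sum>l\<in>{1..length v}. L l) + (\<Sum>k\<in>{1..length u}. K k + (\<Sum>l\<in>{1..length v}. 0)) =
        shuffle (coext \<phi> u) (coext \<phi> v)"
      using False by (simp add: shuffle_coext add.commute L_def K_def)
    ultimately show ?thesis unfolding G_def by simp
  qed
qed

lemma coalgebra_morphism_multiplicative:
  fixes scV :: "'k::field_char_0 \<Rightarrow> 'v::ab_group_add \<Rightarrow> 'v"
    and scW :: "'k \<Rightarrow> 'w::ab_group_add \<Rightarrow> 'w"
  assumes "graded_space scW W" "coalgebra_morphism scV V scW W F"
    and "\<And>u' v' d. u' \<in> words V \<Longrightarrow> v' \<in> words V \<Longrightarrow>
      length u' + length v' < length u + length v \<or> (u' = u \<and> v' = v) \<Longrightarrow>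
      cogen scW (F (shuffle_words u' v')) d = 0"
    and "u \<in> words V" "v \<in> words V"
  shows "teq scW W (F (shuffle_words u v)) (shuffle (F (gen u)) (F (gen v)))"
proof -
  let ?\<phi> = "\<lambda>u. taylor scW F u (wdeg u)"
  have vs: "vector_space scW" using assms(1) by (simp add: graded_space_def)
  have F: "tensor_map scV V scW W 0 F" using assms(2) by (simp add: coalgebra_morphism_def)
  note lin = tensor_map_flinear [OF F]
  note co = coalgebra_morphism_coext [OF assms(1,2)]
  have \<phi>: "?\<phi> w \<in> W (wdeg w)" if "w \<in> words V" for w
    unfolding taylor_def using tensor_map_tbar [OF F] that by (intro cogen_in_space [OF assms(1)]) simp
  have "F (shuffle_words u v) = lin_ext (\<lambda>w. F (gen w)) (shuffle_words u v)"
    by (rule flinear_eq_lin_ext [OF lin])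
  also have "teq scW W \<dots> (lin_ext (coext ?\<phi>) (shuffle_words u v))"
    using shuffle_words_words [OF assms(4,5)] by (intro teq_lin_ext co) (auto simp: tbar_def)
  also have "teq scW W \<dots> (shuffle (coext ?\<phi> u) (coext ?\<phi> v))"
  proof (rule coext_multiplicative [OF assms(1) \<phi>])
    fix u' v' assume uv: "u' \<in> words V" "v' \<in> words V"
      "length u' + length v' < length u + length v \<or> u' = u \<and> v' = v"
    let ?s = "shuffle_words u' v' :: _ \<Rightarrow>\<^sub>0 'k"
    have "(\<Sum>x\<in>Poly_Mapping.keys ?s. scW (Poly_Mapping.lookup ?s x) (?\<phi> x)) =
        (\<Sum>x\<in>Poly_Mapping.keys ?s. scW (Poly_Mapping.lookup ?s x) (cogen scW (F (gen x)) (wdeg u' + wdeg v')))"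
      by (intro sum.cong) (auto simp: taylor_def shuffle_words_wdeg)
    also have "\<dots> = cogen scW (F ?s) (wdeg u' + wdeg v')"
      unfolding flinear_eq_lin_ext [OF lin, of ?s] cogen_lin_ext [OF vs] ..
    also have "\<dots> = 0" by (rule assms(3) [OF uv])
    finally show "(\<Sum>x\<in>Poly_Mapping.keys ?s. scW (Poly_Mapping.lookup ?s x) (?\<phi> x)) = 0" .
  qed (use assms(4,5) words_iff in auto)
  also have "teq scW W \<dots> (shuffle (F (gen u)) (F (gen v)))"
  proof -
    have "F (gen u) \<in> tbar W" using tensor_map_tbar [OF F] assms(4) by simp
    moreover have "coext ?\<phi> v \<in> tbar W" by (rule coext_tbar [where V = V and W = W and \<phi> = ?\<phi>, OF \<phi> assms(5)])
    ultimately show ?thesis using assms(4,5) by (intro teq_sym [OF shuffle_teq] co)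
  qed
  finally show ?thesis .
qed

section \<open>Shuffles with a boundary\<close>

text \<open>
  Splitting off the first letter, a coderivation either acts on the letters that follow, which gives
  \<open>x B\<close>, or its Taylor coefficient absorbs the first letter together with some of those that follow.
  Only when it absorbs no further letter is the length preserved.
\<close>

lemma coderivation_Cons:
  fixes sc :: "'k::field_char_0 \<Rightarrow> 'v::ab_group_add \<Rightarrow> 'v"
  assumes "graded_space sc V" "coderivation sc V d Q" "x \<in> V i" "u \<in> words0 V"
  obtains A B where "A \<in> tbar V" "\<And>w. w \<in> Poly_Mapping.keys A \<Longrightarrow> length w \<le> length u" "B \<in> tbar0 V"
    "teq sc V (Q (gen ((i, x) # u))) (gen ((i + d, taylor sc Q [(i, x)] (i + d)) # u) + A + prepend (i, x) B)"
proof -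
  let ?w = "(i, x) # u"
  have Q: "tensor_map sc V sc V d Q"
    and Qc: "\<And>w. w \<in> words V \<Longrightarrow> teq2 sc V (coproduct (Q (gen w)))
        (map_otimes Q 0 id (coproduct (gen w)) + map_otimes id d Q (coproduct (gen w)))"
    using assms(2) by (auto simp: coderivation_def)
  have w: "?w \<in> words V" using assms(3,4) by (simp add: words_iff)
  note rec = tensor_map_teq2 [OF assms(1) Q w Qc [OF w]]
  show thesis
  proof (cases "u = []")
    case True
    then have "teq sc V (Q (gen ?w)) (gen ((i + d, taylor sc Q [(i, x)] (i + d)) # u) + 0 + prepend (i, x) 0)"
      using rec by (simp add: flinear_add [OF flinear_join] join_map_otimes_coproduct prepend_def)
    then show thesis by (intro that [of 0 0]) auto
  next
    case False
    let ?q = "gen [(wdeg ?w + d, taylor sc Q ?w (wdeg ?w + d))] :: _ \<Rightarrow>\<^sub>0 'k"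
    let ?h = "\<lambda>k. head_join (Q (gen (take k ?w))) (gen (drop k ?w))"
    \<comment> \<open>The summand \<open>k = 1\<close> is the one in which the Taylor coefficient absorbs \<open>x\<close> alone.\<close>
    define A where "A = ?q + (\<Sum>k\<in>{2..<length ?w}. ?h k)"
    define B where "B = fscale (ksgn (d * i)) (Q (gen u))"
    have split: "{1..<length ?w} = insert 1 {2..<length ?w}" using False by (cases u) auto
    have 1: "(\<Sum>k\<in>{1..<length ?w}. ?h k) = head_join (Q (gen [(i, x)])) (gen u) + (\<Sum>k\<in>{2..<length ?w}. ?h k)"
      unfolding split by simp
    have "(\<Sum>k\<in>{1..<length ?w}. fscale (ksgn (d * wdeg (take k ?w))) (head_join (gen (take k ?w)) (Q (gen (drop k ?w))))) =
        fscale (ksgn (d * i)) (prepend (i, x) (Q (gen u))) +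
        (\<Sum>k\<in>{2..<length ?w}. fscale (ksgn (d * wdeg (take k ?w))) (head_join (gen (take k ?w)) (Q (gen (drop k ?w)))))"
      unfolding split by simp
    also have "(\<Sum>k\<in>{2..<length ?w}. fscale (ksgn (d * wdeg (take k ?w))) (head_join (gen (take k ?w)) (Q (gen (drop k ?w))))) = 0"
      by (intro sum.neutral) auto
    finally have 2: "(\<Sum>k\<in>{1..<length ?w}. fscale (ksgn (d * wdeg (take k ?w))) (head_join (gen (take k ?w)) (Q (gen (drop k ?w))))) =
        prepend (i, x) B"
      by (simp add: B_def flinear_fscale [OF flinear_prepend])
    have "teq sc V (Q (gen ?w)) (?q + ((\<Sum>k\<in>{1..<length ?w}. ?h k) + prepend (i, x) B))"
      using rec unfolding flinear_add [OF flinear_join] join_map_otimes_coproduct id_apply 2 by simp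
    also have "?q + ((\<Sum>k\<in>{1..<length ?w}. ?h k) + prepend (i, x) B) =
        head_join (Q (gen [(i, x)])) (gen u) + A + prepend (i, x) B"
      unfolding 1 A_def by (simp add: add_ac)
    also have "teq sc V \<dots> (gen ((i + d, taylor sc Q [(i, x)] (i + d)) # u) + A + prepend (i, x) B)"
      using tensor_map_head_join [OF assms(1) Q, of "[(i, x)]" "gen u"] assms(3,4)
      by (intro teq_add teq_refl) (simp add: words_iff)
    finally have *: "teq sc V (Q (gen ?w)) (gen ((i + d, taylor sc Q [(i, x)] (i + d)) # u) + A + prepend (i, x) B)" .
    have Qt: "Q (gen v) \<in> tbar V" if "v \<in> words V" for v
      using tensor_map_tbar [OF Q] that by simp
    have keys_h: "Poly_Mapping.keys (head_join s (gen v)) \<subseteq> {y \<in> words V. length y = Suc (length v)}"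
      if "s \<in> tbar V" "v \<in> words0 V" for s :: "_ \<Rightarrow>\<^sub>0 'k" and v
    proof -
      have "Poly_Mapping.keys (if length y = 1 then prepend (hd y) (gen v) else 0 :: _ \<Rightarrow>\<^sub>0 'k)
          \<subseteq> {y \<in> words V. length y = Suc (length v)}" if "y \<in> Poly_Mapping.keys s" for y
        using that \<open>s \<in> tbar V\<close> \<open>v \<in> words0 V\<close> by (cases y) (auto simp: tbar_def words_iff)
      then show ?thesis unfolding head_join_def
        by (intro subset_trans [OF keys_lin_ext UN_least])
    qed
    have "Poly_Mapping.keys ?q \<subseteq> {y \<in> words V. length y \<le> length u}"
      using False cogen_in_space [OF assms(1) Qt [OF w]] by (cases u) (simp_all add: taylor_def words_iff)
    moreover have "Poly_Mapping.keys (\<Sum>k\<in>{2..<length ?w}. ?h k) \<subseteq> {y \<in> words V. length y \<le> length u}"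
    proof (rule subset_trans [OF keys_sum], rule UN_least)
      fix k assume k: "k \<in> {2..<length ?w}"
      have "take k ?w \<in> words V" "drop k ?w \<in> words0 V"
        using w k words0_take_drop[of ?w V k] by (auto simp: words_iff)
      from keys_h [OF Qt [OF this(1)] this(2)]
      show "Poly_Mapping.keys (?h k) \<subseteq> {y \<in> words V. length y \<le> length u}"
        using k by auto
    qed
    ultimately have "Poly_Mapping.keys A \<subseteq> {y \<in> words V. length y \<le> length u}"
      unfolding A_def by (meson Poly_Mapping.keys_add Un_least subset_trans)
    moreover have "B \<in> tbar0 V"
      unfolding B_def using False assms(4) by (intro tbar0_fscale tbar_tbar0 Qt) (simp add: words_iff)
    ultimately show thesis using * by (intro that [of A B]) (auto simp: tbar_def)
  qed
qed

lemma cogen_shuffle_derivation: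
  assumes "graded_space sc V" "tensor_map sc V sc V d Q" "shuffle_derivation sc V d Q" "s \<in> tbar V" "t \<in> tbar V"
  shows "cogen sc (Q (shuffle s t)) e = 0"
proof -
  have vs: "vector_space sc" using assms(1) by (simp add: graded_space_def)
  interpret vector_space sc by (fact vs)
  have "cogen sc (Q (shuffle_words u v)) e = 0" if "u \<in> words V" "v \<in> words V" for u v
  proof -
    have "teq sc V (Q (shuffle_words u v))
        (shuffle (Q (gen u)) (gen v) + fscale (ksgn (d * wdeg u)) (shuffle (gen u) (Q (gen v))))"
      using assms(3) that by (simp add: shuffle_derivation_def)
    then have "cogen sc (Q (shuffle_words u v)) e = cogen sc (shuffle (Q (gen u)) (gen v)) e
        + sc (ksgn (d * wdeg u)) (cogen sc (shuffle (gen u) (Q (gen v))) e)"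
      by (simp only: cogen_teq [OF vs] cogen_add [OF vs] cogen_fscale [OF vs])
    then show ?thesis
      using that tensor_map_tbar [OF assms(2)] by (simp add: cogen_shuffle [OF vs, of _ V])
  qed
  then show ?thesis
    unfolding shuffle_def flinear_comp_lin_ext [OF tensor_map_flinear [OF assms(2)]]
    using assms(4,5) by (intro cogen_lin_ext_zero [OF vs]) (auto simp: tbar_def)
qed

lemma prepend_shuffle_keys:
  assumes "w \<in> Poly_Mapping.keys (shuffle (prepend l s) t :: _ \<Rightarrow>\<^sub>0 'k::field_char_0)"
    and "s \<in> tbar0 V" "t \<in> tbar V" "snd l \<in> V (fst l)"
  shows "w \<in> words V \<and> 2 \<le> length w \<and> l \<in> set w"
proof -
  have "w \<in> Poly_Mapping.keys (lin_ext (\<lambda>u. lin_ext (\<lambda>v. shuffle_words (l # u) v) t) s)"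
    using assms(1) by (simp add: shuffle_def prepend_def lin_ext_lin_ext)
  then obtain u v where u: "u \<in> Poly_Mapping.keys s" and v: "v \<in> Poly_Mapping.keys t"
    and w: "w \<in> Poly_Mapping.keys (shuffle_words (l # u) v :: _ \<Rightarrow>\<^sub>0 'k)"
    by (elim keys_lin_extE)
  have "l # u \<in> words V" "v \<in> words V"
    using u v assms(2-4) by (cases l; auto simp: tbar0_def tbar_def words_iff)+
  then have "shuffle_words (l # u) v \<in> tbar V" by (rule shuffle_words_words)
  moreover have "v \<noteq> []" using \<open>v \<in> words V\<close> by (simp add: words_iff)
  ultimately show ?thesis
    using w shuffle_words_length [OF w] shuffle_words_set [OF w] by (cases v) (auto simp: tbar_def)
qed

text \<open>
  The inductive step for a first letter that is a boundary \<open>Q\<^sub>1 x\<close>: the assumption that \<open>F\<close> ignores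
  words with the letter \<open>x\<close> is used both to make \<open>F\<close> multiplicative on \<open>x u \<circledast> v\<close> and to discard
  all terms of \<open>Q (x u \<circledast> v)\<close> in which \<open>x\<close> survives.
\<close>

lemma cogen_shuffle_boundary:
  fixes scV :: "'k::field_char_0 \<Rightarrow> 'v::ab_group_add \<Rightarrow> 'v"
    and scW :: "'k \<Rightarrow> 'w::ab_group_add \<Rightarrow> 'w"
  assumes V: "graded_space scV V" "coderivation scV V 1 Q" "shuffle_derivation scV V 1 Q"
    and W: "graded_space scW W" "coderivation scW W 1 R" "shuffle_derivation scW W 1 R"
    and F: "coalgebra_morphism scV V scW W F"
    and comm: "\<And>w. w \<in> words V \<Longrightarrow> teq scW W (F (Q (gen w))) (R (F (gen w)))"
    and x: "x \<in> V i" and u: "u \<in> words0 V" and v: "v \<in> words V"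
    and van: "\<And>w. w \<in> words V \<Longrightarrow> 2 \<le> length w \<Longrightarrow> (i, x) \<in> set w \<Longrightarrow> taylor scW F w = (\<lambda>d. 0)"
    and IH: "\<And>u' v' d. u' \<in> words V \<Longrightarrow> v' \<in> words V \<Longrightarrow> length u' + length v' < Suc (length u) + length v \<Longrightarrow>
      cogen scW (F (shuffle_words u' v')) d = 0"
  shows "cogen scW (F (shuffle_words ((i + 1, taylor scV Q [(i, x)] (i + 1)) # u) v)) d = 0"
proof -
  let ?a = "(i, x) # u" and ?b = "(i + 1, taylor scV Q [(i, x)] (i + 1)) # u"
  have vs: "vector_space scW" using W(1) by (simp add: graded_space_def)
  interpret scW: vector_space scW by (fact vs)
  have Fm: "tensor_map scV V scW W 0 F" using F by (simp add: coalgebra_morphism_def)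
  have Qm: "tensor_map scV V scV V 1 Q" using V(2) by (simp add: coderivation_def)
  have Rm: "tensor_map scW W scW W 1 R" using W(2) by (simp add: coderivation_def)
  note Fl = tensor_map_flinear [OF Fm] and Ql = tensor_map_flinear [OF Qm] and Rl = tensor_map_flinear [OF Rm]
  have a: "?a \<in> words V" using x u by (simp add: words_iff)
  have cogF: "cogen scW (F t) d = 0" if "\<And>w. w \<in> Poly_Mapping.keys t \<Longrightarrow> w \<in> words V \<and> 2 \<le> length w \<and> (i, x) \<in> set w" for t d
    unfolding flinear_eq_lin_ext [OF Fl, of t] using that van
    by (intro cogen_lin_ext_zero [OF vs]) (auto simp: taylor_def fun_eq_iff)
  have vanish: "cogen scW (F (shuffle (prepend (i, x) s) t)) d = 0" if "s \<in> tbar0 V" "t \<in> tbar V" for s t d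
    by (rule cogF, erule prepend_shuffle_keys) (use that x in auto)
  have aa: "gen ?a = prepend (i, x) (gen u)" by simp
  have vanish_a: "cogen scW (F (shuffle (gen ?a) t)) d = 0" if "t \<in> tbar V" for t d
    unfolding aa by (rule vanish) (use u that in simp_all)
  have mult: "teq scW W (F (shuffle_words ?a v)) (shuffle (F (gen ?a)) (F (gen v)))"
  proof (rule coalgebra_morphism_multiplicative [OF W(1) F _ a v])
    fix u' v' d assume "u' \<in> words V" "v' \<in> words V"
      "length u' + length v' < length ?a + length v \<or> u' = ?a \<and> v' = v"
    then show "cogen scW (F (shuffle_words u' v')) d = 0"
      using IH vanish_a[of "gen v" d] v by auto
  qed
  have FQ: "teq scW W (F (Q s)) (R (F s))" if "s \<in> tbar V" for s
  proof -
    have "F (Q s) = lin_ext (\<lambda>w. F (Q (gen w))) s" "R (F s) = lin_ext (\<lambda>w. R (F (gen w))) s"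
      by (simp_all add: flinear_eq_lin_ext [OF Ql, of s] flinear_eq_lin_ext [OF Fl, of s]
          flinear_comp_lin_ext [OF Fl] flinear_comp_lin_ext [OF Rl])
    then show ?thesis using that comm by (auto intro!: teq_lin_ext simp: tbar_def)
  qed
  have Qa: "Q (gen ?a) \<in> tbar V" "Q (gen v) \<in> tbar V"
    using tensor_map_tbar [OF Qm] a v by simp_all
  \<comment> \<open>First evaluation of the linear part of \<open>F (Q (x u \<circledast> v))\<close>: it vanishes because \<open>R\<close>
    maps shuffles to sums of shuffles.\<close>
  have "cogen scW (F (Q (shuffle_words ?a v))) d = cogen scW (R (F (shuffle_words ?a v))) d"
    by (rule cogen_teq [OF vs FQ [OF shuffle_words_words [OF a v]]])
  also have "\<dots> = cogen scW (R (shuffle (F (gen ?a)) (F (gen v)))) d"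
    by (rule cogen_teq [OF vs tensor_map_teq [OF Rm mult]])
  also have "\<dots> = 0"
    using tensor_map_tbar [OF Fm] a v by (intro cogen_shuffle_derivation [OF W(1) Rm W(3)]) auto
  finally have 0: "cogen scW (F (Q (shuffle_words ?a v))) d = 0" .
  \<comment> \<open>Second evaluation: expand \<open>Q (x u \<circledast> v)\<close>; the only summand that can contribute is
    the one of the claim.\<close>
  obtain A B where A: "A \<in> tbar V" "\<And>w. w \<in> Poly_Mapping.keys A \<Longrightarrow> length w \<le> length u" and B: "B \<in> tbar0 V"
    and Qeq: "teq scV V (Q (gen ?a)) (gen ?b + A + prepend (i, x) B)"
    using coderivation_Cons [OF V(1,2) x u] by blast
  have "teq scV V (Q (shuffle_words ?a v))
      (shuffle (Q (gen ?a)) (gen v) + fscale (ksgn (1 * wdeg ?a)) (shuffle (gen ?a) (Q (gen v))))"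
    using V(3) a v unfolding shuffle_derivation_def by fastforce
  also have "teq scV V \<dots> (shuffle (gen ?b + A + prepend (i, x) B) (gen v)
      + fscale (ksgn (1 * wdeg ?a)) (shuffle (gen ?a) (Q (gen v))))"
    using Qa v by (intro teq_add teq_refl shuffle_teq Qeq) auto
  finally have "cogen scW (F (Q (shuffle_words ?a v))) d =
      cogen scW (F (shuffle (gen ?b + A + prepend (i, x) B) (gen v)
      + fscale (ksgn (1 * wdeg ?a)) (shuffle (gen ?a) (Q (gen v))))) d"
    by (rule cogen_teq [OF vs tensor_map_teq [OF Fm]])
  also have "\<dots> = cogen scW (F (shuffle_words ?b v)) d + cogen scW (F (shuffle A (gen v))) d
      + cogen scW (F (shuffle (prepend (i, x) B) (gen v))) d
      + scW (ksgn (1 * wdeg ?a)) (cogen scW (F (shuffle (gen ?a) (Q (gen v)))) d)"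
    by (simp only: shuffle_add_left shuffle_gen flinear_add [OF Fl] flinear_fscale [OF Fl] cogen_add [OF vs] cogen_fscale [OF vs])
  also have "cogen scW (F (shuffle (gen ?a) (Q (gen v)))) d = 0" by (rule vanish_a [OF Qa(2)])
  also have "cogen scW (F (shuffle (prepend (i, x) B) (gen v))) d = 0" using vanish [OF B] v by simp
  also have "cogen scW (F (shuffle A (gen v))) d = 0"
    unfolding shuffle_gen_right flinear_comp_lin_ext [OF Fl]
  proof (rule cogen_lin_ext_zero [OF vs])
    fix w assume w: "w \<in> Poly_Mapping.keys A"
    then show "cogen scW (F (shuffle_words w v)) d = 0"
      using A(1) A(2)[OF w] v by (intro IH) (auto simp: tbar_def)
  qed
  finally show ?thesis using 0 by simp
qed

theorem lemma2p13:
  fixes scV :: "'k::field_char_0 \<Rightarrow> 'v::ab_group_add \<Rightarrow> 'v"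
    and scW :: "'k \<Rightarrow> 'w::ab_group_add \<Rightarrow> 'w"
    and V X Y :: "int \<Rightarrow> 'v set" and W :: "int \<Rightarrow> 'w set"
    and Q :: "('v word \<Rightarrow>\<^sub>0 'k) \<Rightarrow> ('v word \<Rightarrow>\<^sub>0 'k)"
    and R :: "('w word \<Rightarrow>\<^sub>0 'k) \<Rightarrow> ('w word \<Rightarrow>\<^sub>0 'k)"
    and F :: "('v word \<Rightarrow>\<^sub>0 'k) \<Rightarrow> ('w word \<Rightarrow>\<^sub>0 'k)"
  assumes "C_inf_algebra scV V Q" and "C_inf_algebra scW W R"
    and "graded_direct_sum scV V X Y"
    and "\<And>i. susp Y (i + 1) \<subseteq> (\<lambda>x. taylor scV Q [(i, x)] (i + 1)) ` susp X i"
    and "A_inf_morphism scV V Q scW W R F"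
    and "\<And>w. w \<in> words (susp V) \<Longrightarrow> length w \<ge> 2 \<Longrightarrow> (\<exists>(i, x) \<in> set w. x \<in> susp X i) \<Longrightarrow>
           taylor scW F w = (\<lambda>d. 0)"
  shows "C_inf_morphism scV V Q scW W R F"
proof -
  have V: "graded_space scV (susp V)" "coderivation scV (susp V) 1 Q" "shuffle_derivation scV (susp V) 1 Q"
    and W: "graded_space scW (susp W)" "coderivation scW (susp W) 1 R" "shuffle_derivation scW (susp W) 1 R"
    and F: "coalgebra_morphism scV (susp V) scW (susp W) F"
    and comm: "\<And>w. w \<in> words (susp V) \<Longrightarrow> teq scW (susp W) (F (Q (gen w))) (R (F (gen w)))"
    using assms(1,2,5)
    by (auto simp: C_inf_algebra_def A_inf_algebra_def A_inf_morphism_def graded_space_def susp_def)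
  have vsV: "vector_space scV" and vs: "vector_space scW" using V(1) W(1) by (simp_all add: graded_space_def)
  interpret scV: vector_space scV by (fact vsV)
  interpret scW: vector_space scW by (fact vs)
  have Fm: "tensor_map scV (susp V) scW (susp W) 0 F" using F by (simp add: coalgebra_morphism_def)
  note Fl = tensor_map_flinear [OF Fm]
  have X: "0 \<in> X i" and Y: "0 \<in> Y i" and sum: "V i = {x + y | x y. x \<in> X i \<and> y \<in> Y i}" for i
    using assms(3) scV.subspace_0 by (auto simp: graded_direct_sum_def graded_space_def)
  have XV: "X i \<subseteq> V i" and YV: "Y i \<subseteq> V i" for i
    unfolding sum[of i] using X Y by (force intro: exI[of _ 0])+
  have kill: "cogen scW (F (shuffle_words u v)) d = 0" if "u \<in> words (susp V)" "v \<in> words (susp V)" for u v d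
    using that
  proof (induction "length u + length v" arbitrary: u v d rule: less_induct)
    case less
    obtain j z u' where u_eq: "u = (j, z) # u'" using less.prems(1) by (cases u) (auto simp: words_iff)
    have z: "z \<in> susp V j" and u': "u' \<in> words0 (susp V)" using less.prems(1) by (auto simp: u_eq words_iff)
    obtain x y where xy: "z = x + y" "x \<in> susp X j" "y \<in> susp Y j"
      using z sum by (auto simp: susp_def)
    obtain x' where x': "x' \<in> susp X (j - 1)" and y: "y = taylor scV Q [(j - 1, x')] j"
      using assms(4)[of "j - 1"] xy(3) by auto
    have inV: "x \<in> susp V j" "y \<in> susp V j" "x' \<in> susp V (j - 1)"
      using xy x' XV YV by (auto simp: susp_def)
    have "teq scV (susp V) (gen u) (gen ((j, x) # u') + gen ((j, y) # u'))"
      using prepend_combination [OF V(1) inV(1,2), of "gen u'" 1 1] u' by (simp add: u_eq xy(1))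
    then have "teq scV (susp V) (shuffle (gen u) (gen v)) (shuffle (gen ((j, x) # u') + gen ((j, y) # u')) (gen v))"
      using less.prems by (intro shuffle_teq) auto
    then have "cogen scW (F (shuffle_words u v)) d =
        cogen scW (F (shuffle_words ((j, x) # u') v)) d + cogen scW (F (shuffle_words ((j, y) # u') v)) d"
      using cogen_teq [OF vs tensor_map_teq [OF Fm]]
      by (simp add: shuffle_add_left flinear_add [OF Fl] cogen_add [OF vs])
    \<comment> \<open>A first letter in \<open>X\<close> occurs in every word of the shuffle.\<close>
    also have "cogen scW (F (shuffle_words ((j, x) # u') v)) d = 0"
      unfolding flinear_eq_lin_ext [OF Fl, of "shuffle_words _ _"]
    proof (rule cogen_lin_ext_zero [OF vs])
      fix w assume "w \<in> Poly_Mapping.keys (shuffle_words ((j, x) # u') v :: _ \<Rightarrow>\<^sub>0 'k)"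
      then have "w \<in> words (susp V) \<and> 2 \<le> length w \<and> (j, x) \<in> set w"
        using prepend_shuffle_keys[of w "(j, x)" "gen u'" "gen v" "susp V"] inV(1) u' less.prems(2) by simp
      then have "taylor scW F w = (\<lambda>d. 0)" using xy(2) by (intro assms(6)) auto
      then show "cogen scW (F (gen w)) d = 0" by (simp add: taylor_def fun_eq_iff)
    qed
    \<comment> \<open>A first letter in \<open>Y\<close> is the boundary of \<open>x'\<close>, which lies one degree below.\<close>
    also have "cogen scW (F (shuffle_words ((j, y) # u') v)) d = 0"
      using cogen_shuffle_boundary [OF V W F comm inV(3) u' less.prems(2), of d] x' less.hyps
      by (simp add: y u_eq) (metis (mono_tags, lifting) assms(6) case_prodI)
    finally show ?case by simp
  qed
  have "shuffle_morphism (susp V) scW (susp W) F"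
    unfolding shuffle_morphism_def shuffle_gen
    by (intro ballI coalgebra_morphism_multiplicative [OF W(1) F] kill)
  then show ?thesis using assms by (simp add: C_inf_morphism_def)
qed

end
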